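(* Let $(\lambda,\boldsymbol\mu)$ and $(\lambda',\boldsymbol\nu)$ be admissible parameters such that $M^{(\lambda,\boldsymbol\mu)}$ and $M^{(\lambda',\boldsymbol\nu)}$ are not unitarily equivalent, while the curvatures $\mathcal K_{\lambda,\boldsymbol\mu}(z)$ and $\mathcal K_{\lambda',\boldsymbol\nu}(z)$ are unitarily equivalent for every $z\in\mathbb D$. Then there is no invertible matrix $L\in\mathcal M(3,\mathbb C)$ satisfying both $L\,\mathcal K_{\lambda,\boldsymbol\mu}(0)=\mathcal K_{\lambda',\boldsymbol\nu}(0)\,L$ and $L\,(\mathcal K_{\lambda,\boldsymbol\mu})_{\bar z}(0)=(\mathcal K_{\lambda',\boldsymbol\nu})_{\bar z}(0)\,L$.
   Context: Admissible parameters: a real $\lambda>1$ and $\boldsymbol\mu=(1,\mu_1,\mu_2)$ with $\mu_1,\mu_2>0$. Put $m=2$, $\mu_0=1$, $2\lambda_j=2\lambda-m+2j$, let $(x)_k=x(x+1)\cdots(x+k-1)$, and $$d_\ell=\sum_{j=0}^{\ell}\binom{\ell}{j}^2\frac{(\ell-j)!}{(2\lambda_j)_{\ell-j}}\mu_j^2,\quad 0\le\ell\le 2,\qquad \mathrm B=\mathrm{diag}(d_0,d_1,d_2).$$ Let $\mathbb S_2$ be the $3\times3$ matrix (indices $0,1,2$) with $(\mathbb S_2)_{\ell,\ell-1}=\ell$ and other entries $0$, and $D(x)=\mathrm{diag}((1-x)^2,1-x,1)$. The reproducing kernel $$K^{(\lambda,\boldsymbol\mu)}(z,w)=(1-z\bar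 w)^{-2\lambda-2}D(z\bar w)\exp(\bar w\,\mathbb S_2)\,\mathrm B\,\exp(z\,\mathbb S_2^* )D(z\bar w)$$ on the open unit disc $\mathbb D$ determines a Hilbert space of $\mathbb C^3$-valued holomorphic functions, and $M^{(\lambda,\boldsymbol\mu)}$ is multiplication by the coordinate function on it. (It is known that $M^{(\lambda,\boldsymbol\mu)}$ is bounded, homogeneous and irreducible, and its adjoint is in the Cowen–Douglas class $\mathrm B_3(\mathbb D)$.) The normalized kernel of a kernel $K$ with $K(0,0)$ invertible is $\tilde K(z,w)=K(0,0)^{1/2}K(z,0)^{-1}K(z,w)K(0,w)^{-1}K(0,0)^{1/2}$. Set $\tilde h(z)=\tilde K^{(\lambda,\boldsymbol\mu)}(z,z)^t$ ($t$ = transpose); $\mathcal K_{\lambda,\boldsymbol\mu}(z)=\bar\partial(\tilde h^{-1}\partial\tilde h)(z)$ is its curvature, acting on $\mathbb C^3$ with inner product $\langle x,y\rangle=y^*\tilde h(z)x$, and the covariant derivative of order $(0,1)$ is $(\mathcal K_{\lambda,\boldsymbol\mu})_{\bar z}=\bar\partial\mathcal K_{\lambda,\boldsymbol\mu}$. Curvatures at $z$ are unitarily equivalent if intertwined by a unitary map between the corresponding inner product spaces (at $z=0$ both inner products are the standard one). *)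

theory Defs
  imports "HOL-Analysis.Analysis"
begin

subsection \<open>Complex matrices\<close>

text \<open>Linear in the first argument: \<open>cinner x y\<close> is \<open>y\<^sup>* x\<close>.\<close>

definition cinner :: "complex^'n \<Rightarrow> complex^'n \<Rightarrow> complex" where
  "cinner x y = (\<Sum>i\<in>UNIV. x $ i * cnj (y $ i))"

definition mat_adjoint :: "complex^'n^'m \<Rightarrow> complex^'m^'n" where
  "mat_adjoint A = map_matrix cnj (transpose A)"

definition mat_scale :: "complex \<Rightarrow> complex^'n^'m \<Rightarrow> complex^'n^'m" where
  "mat_scale c A = map_matrix ((*) c) A"

text \<open>On this type the operation \<open>*\<close> is componentwise, so powers are taken with respect to \<open>**\<close>.\<close>

definition mat_power :: "complex^'n^'n \<Rightarrow> nat \<Rightarrow> complex^'n^'n" where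
  "mat_power A k = (((**) A) ^^ k) (mat 1)"

definition mat_exp :: "complex^'n^'n \<Rightarrow> complex^'n^'n" where
  "mat_exp A = (\<Sum>k. (1 / fact k) *\<^sub>R mat_power A k)"

definition mat_psd :: "complex^'n^'n \<Rightarrow> bool" where
  "mat_psd A \<longleftrightarrow> mat_adjoint A = A \<and> (\<forall>x. 0 \<le> Re (cinner (A *v x) x))"

definition mat_sqrt :: "complex^'n^'n \<Rightarrow> complex^'n^'n" where
  "mat_sqrt A = (THE R. mat_psd R \<and> R ** R = A)"

definition diag3 :: "complex \<Rightarrow> complex \<Rightarrow> complex \<Rightarrow> complex^3^3" where
  "diag3 a b c = vector [vector [a, 0, 0], vector [0, b, 0], vector [0, 0, c]]"

subsection \<open>Wirtinger derivatives, taken entrywise for matrix-valued functions\<close>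

definition wirt :: "(complex \<Rightarrow> complex) \<Rightarrow> complex \<Rightarrow> complex" where
  "wirt f z = (frechet_derivative f (at z) 1 - \<i> * frechet_derivative f (at z) \<i>) / 2"

definition wirt_bar :: "(complex \<Rightarrow> complex) \<Rightarrow> complex \<Rightarrow> complex" where
  "wirt_bar f z = (frechet_derivative f (at z) 1 + \<i> * frechet_derivative f (at z) \<i>) / 2"

definition mat_wirt :: "(complex \<Rightarrow> complex^'n^'m) \<Rightarrow> complex \<Rightarrow> complex^'n^'m" where
  "mat_wirt F z = (\<chi> i j. wirt (\<lambda>u. F u $ i $ j) z)"

definition mat_wirt_bar :: "(complex \<Rightarrow> complex^'n^'m) \<Rightarrow> complex \<Rightarrow> complex^'n^'m" where
  "mat_wirt_bar F z = (\<chi> i j. wirt_bar (\<lambda>u. F u $ i $ j) z)"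

subsection \<open>Normalized kernels, metrics and curvatures\<close>

definition normalized_kernel ::
    "(complex \<Rightarrow> complex \<Rightarrow> complex^'n^'n) \<Rightarrow> complex \<Rightarrow> complex \<Rightarrow> complex^'n^'n" where
  "normalized_kernel K z w =
     mat_sqrt (K 0 0) ** matrix_inv (K z 0) ** K z w ** matrix_inv (K 0 w) ** mat_sqrt (K 0 0)"

definition kernel_metric ::
    "(complex \<Rightarrow> complex \<Rightarrow> complex^'n^'n) \<Rightarrow> complex \<Rightarrow> complex^'n^'n" where
  "kernel_metric K z = transpose (normalized_kernel K z z)"

definition curvature :: "(complex \<Rightarrow> complex^'n^'n) \<Rightarrow> complex \<Rightarrow> complex^'n^'n" where
  "curvature h z = mat_wirt_bar (\<lambda>u. matrix_inv (h u) ** mat_wirt h u) z"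

definition curvature_zbar :: "(complex \<Rightarrow> complex^'n^'n) \<Rightarrow> complex \<Rightarrow> complex^'n^'n" where
  "curvature_zbar h z = mat_wirt_bar (curvature h) z"

definition metric_inner :: "complex^'n^'n \<Rightarrow> complex^'n \<Rightarrow> complex^'n \<Rightarrow> complex" where
  "metric_inner G x y = cinner (G *v x) y"

definition curvatures_unitarily_equivalent ::
    "(complex \<Rightarrow> complex^'n^'n) \<Rightarrow> (complex \<Rightarrow> complex^'n^'n) \<Rightarrow> complex \<Rightarrow> bool" where
  "curvatures_unitarily_equivalent h h' z \<longleftrightarrow>
     (\<exists>U :: complex^'n^'n. invertible U \<and>
        (\<forall>x y. metric_inner (h' z) (U *v x) (U *v y) = metric_inner (h z) x y) \<and>
        U ** curvature h z = curvature h' z ** U)"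

subsection \<open>Reproducing kernel Hilbert spaces on the unit disc\<close>

text \<open>A Hilbert space is given by its set \<open>H\<close> of functions and its inner product \<open>ip\<close>, of which
  only the values on \<open>H\<close> matter. Functions on the disc are represented by functions on \<open>\<complex>\<close> that
  vanish off the disc, so that distinct elements of the space are distinct functions.\<close>

definition complex_inner_space ::
    "(complex \<Rightarrow> complex^'n) set \<Rightarrow>
     ((complex \<Rightarrow> complex^'n) \<Rightarrow> (complex \<Rightarrow> complex^'n) \<Rightarrow> complex) \<Rightarrow> bool" where
  "complex_inner_space H ip \<longleftrightarrow>
     (\<lambda>z. 0) \<in> H \<and>
     (\<forall>f\<in>H. \<forall>g\<in>H. (\<lambda>z. f z + g z) \<in> H) \<and>
     (\<forall>c. \<forall>f\<in>H. (\<lambda>z. c *s f z) \<in> H) \<and>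
     (\<forall>f\<in>H. \<forall>g\<in>H. \<forall>k\<in>H. ip (\<lambda>z. f z + g z) k = ip f k + ip g k) \<and>
     (\<forall>c. \<forall>f\<in>H. \<forall>g\<in>H. ip (\<lambda>z. c *s f z) g = c * ip f g) \<and>
     (\<forall>f\<in>H. \<forall>g\<in>H. ip g f = cnj (ip f g)) \<and>
     (\<forall>f\<in>H. f \<noteq> (\<lambda>z. 0) \<longrightarrow> 0 < Re (ip f f))"

definition ip_dist ::
    "((complex \<Rightarrow> complex^'n) \<Rightarrow> (complex \<Rightarrow> complex^'n) \<Rightarrow> complex) \<Rightarrow>
     (complex \<Rightarrow> complex^'n) \<Rightarrow> (complex \<Rightarrow> complex^'n) \<Rightarrow> real" where
  "ip_dist ip f g = sqrt (Re (ip (\<lambda>z. f z - g z) (\<lambda>z. f z - g z)))"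

definition hilbert_function_space ::
    "(complex \<Rightarrow> complex^'n) set \<Rightarrow>
     ((complex \<Rightarrow> complex^'n) \<Rightarrow> (complex \<Rightarrow> complex^'n) \<Rightarrow> complex) \<Rightarrow> bool" where
  "hilbert_function_space H ip \<longleftrightarrow>
     complex_inner_space H ip \<and>
     (\<forall>F :: nat \<Rightarrow> complex \<Rightarrow> complex^'n.
        (\<forall>n. F n \<in> H) \<and> (\<forall>e>0. \<exists>N. \<forall>m\<ge>N. \<forall>n\<ge>N. ip_dist ip (F m) (F n) < e) \<longrightarrow>
        (\<exists>f\<in>H. (\<lambda>n. ip_dist ip (F n) f) \<longlonglongrightarrow> 0))"

definition kernel_section ::
    "(complex \<Rightarrow> complex \<Rightarrow> complex^'n^'n) \<Rightarrow> complex \<Rightarrow> complex^'n \<Rightarrow> complex \<Rightarrow> complex^'n" where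
  "kernel_section K w x = (\<lambda>z. if z \<in> ball 0 1 then K z w *v x else 0)"

definition rkhs ::
    "(complex \<Rightarrow> complex \<Rightarrow> complex^'n^'n) \<Rightarrow> (complex \<Rightarrow> complex^'n) set \<Rightarrow>
     ((complex \<Rightarrow> complex^'n) \<Rightarrow> (complex \<Rightarrow> complex^'n) \<Rightarrow> complex) \<Rightarrow> bool" where
  "rkhs K H ip \<longleftrightarrow>
     hilbert_function_space H ip \<and>
     (\<forall>f\<in>H. (\<forall>i. (\<lambda>z. f z $ i) holomorphic_on ball 0 1) \<and> (\<forall>z. z \<notin> ball 0 1 \<longrightarrow> f z = 0)) \<and>
     (\<forall>w\<in>ball 0 1. \<forall>x. kernel_section K w x \<in> H \<and>
        (\<forall>f\<in>H. ip f (kernel_section K w x) = cinner (f w) x))"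

definition mult_coord :: "(complex \<Rightarrow> complex^'n) \<Rightarrow> complex \<Rightarrow> complex^'n" where
  "mult_coord f = (\<lambda>z. z *s f z)"

definition unitarily_equivalent ::
    "(complex \<Rightarrow> complex^'n) set \<Rightarrow>
     ((complex \<Rightarrow> complex^'n) \<Rightarrow> (complex \<Rightarrow> complex^'n) \<Rightarrow> complex) \<Rightarrow>
     ((complex \<Rightarrow> complex^'n) \<Rightarrow> complex \<Rightarrow> complex^'n) \<Rightarrow>
     (complex \<Rightarrow> complex^'n) set \<Rightarrow>
     ((complex \<Rightarrow> complex^'n) \<Rightarrow> (complex \<Rightarrow> complex^'n) \<Rightarrow> complex) \<Rightarrow>
     ((complex \<Rightarrow> complex^'n) \<Rightarrow> complex \<Rightarrow> complex^'n) \<Rightarrow> bool" where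
  "unitarily_equivalent H ip T H' ip' T' \<longleftrightarrow>
     (\<exists>U. bij_betw U H H' \<and>
        (\<forall>f\<in>H. \<forall>g\<in>H. U (\<lambda>z. f z + g z) = (\<lambda>z. U f z + U g z)) \<and>
        (\<forall>c. \<forall>f\<in>H. U (\<lambda>z. c *s f z) = (\<lambda>z. c *s U f z)) \<and>
        (\<forall>f\<in>H. \<forall>g\<in>H. ip' (U f) (U g) = ip f g) \<and>
        (\<forall>f\<in>H. U (T f) = T' (U f)))"

subsection \<open>The homogeneous kernels of rank 3\<close>

text \<open>Only \<open>\<mu> 0\<close>, \<open>\<mu> 1\<close>, \<open>\<mu> 2\<close> are used; they are the entries of \<open>\<mu> = (1, \<mu>\<^sub>1, \<mu>\<^sub>2)\<close>.\<close>

definition admissible :: "real \<Rightarrow> (nat \<Rightarrow> real) \<Rightarrow> bool" where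
  "admissible lam \<mu> \<longleftrightarrow> lam > 1 \<and> \<mu> 0 = 1 \<and> \<mu> 1 > 0 \<and> \<mu> 2 > 0"

text \<open>Here \<open>2 * lam - 2 + 2 * j\<close> is \<open>2\<lambda>\<^sub>j\<close> for \<open>m = 2\<close>.\<close>

definition dcoef :: "real \<Rightarrow> (nat \<Rightarrow> real) \<Rightarrow> nat \<Rightarrow> real" where
  "dcoef lam \<mu> l =
     (\<Sum>j=0..l. (real (l choose j))\<^sup>2 * fact (l - j)
        / pochhammer (2 * lam - 2 + 2 * real j) (l - j) * (\<mu> j)\<^sup>2)"

definition Bmat :: "real \<Rightarrow> (nat \<Rightarrow> real) \<Rightarrow> complex^3^3" where
  "Bmat lam \<mu> = diag3 (of_real (dcoef lam \<mu> 0)) (of_real (dcoef lam \<mu> 1)) (of_real (dcoef lam \<mu> 2))"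

text \<open>The indices 0, 1, 2 of the mathematical matrices are the positions in the lists.\<close>

definition Smat :: "complex^3^3" where
  "Smat = vector [vector [0, 0, 0], vector [1, 0, 0], vector [0, 2, 0]]"

definition Dmat :: "complex \<Rightarrow> complex^3^3" where
  "Dmat x = diag3 ((1 - x)\<^sup>2) (1 - x) 1"

text \<open>For \<open>z\<close>, \<open>w\<close> in the disc, \<open>1 - z * cnj w\<close> has positive real part, and \<open>powr\<close> is the
  principal branch.\<close>

definition Kker :: "real \<Rightarrow> (nat \<Rightarrow> real) \<Rightarrow> complex \<Rightarrow> complex \<Rightarrow> complex^3^3" where
  "Kker lam \<mu> z w =
     mat_scale ((1 - z * cnj w) powr complex_of_real (- 2 * lam - 2))
       (Dmat (z * cnj w) ** mat_exp (mat_scale (cnj w) Smat) ** Bmat lam \<mu>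
          ** mat_exp (mat_scale z (mat_adjoint Smat)) ** Dmat (z * cnj w))"

end

theory Submission
  imports Defs "HOL-Complex_Analysis.Cauchy_Integral_Formula"
begin

text \<open>
  Put \<open>a = 1 / d\<^sub>1\<close>, \<open>b = 4 d\<^sub>1 / d\<^sub>2\<close>. Conjugating the weighted shift by \<open>B\<^bsup>1/2\<^esup>\<close> removes \<open>B\<close> from
  the normalized metric, which becomes a product of \<open>exp (z A)\<close>, \<open>exp (cnj z A\<^sup>*)\<close> and radial diagonal
  factors, where \<open>A\<close> has subdiagonal \<open>(sqrt a, sqrt b)\<close>. At \<open>0\<close> the curvature is then \<open>diag (k\<^sub>0, k\<^sub>1, k\<^sub>2)\<close>
  with \<open>k\<^sub>0 = 2\<lambda> - 2 - a\<close>, \<open>k\<^sub>1 = 2\<lambda> + a - b\<close>, \<open>k\<^sub>2 = 2\<lambda> + 2 + b\<close>, and its covariant derivative has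
  superdiagonal \<open>(- sqrt a (k\<^sub>1 - k\<^sub>0), - sqrt b (k\<^sub>2 - k\<^sub>1))\<close>. As \<open>k\<^sub>0 < k\<^sub>2\<close> always, a matrix \<open>L\<close>
  intertwining both pairs can only match \<open>k\<^sub>i\<close> with \<open>k\<^sub>i'\<close>. This gives \<open>\<lambda> = \<lambda>'\<close> (trace), \<open>a = a'\<close>,
  \<open>b = b'\<close>, so both operators come from the same kernel, and a kernel determines its Hilbert space.
\<close>

subsection \<open>Jets in the conjugate variable\<close>

text \<open>The real-linear derivative is written in the basis \<open>t\<close>,
  \<open>cnj t\<close>, so \<open>p\<close> and \<open>q\<close> are the two Wirtinger derivatives.
  Being a relation, it also carries differentiability, which \<open>wirt\<close> and
  \<open>wirt_bar\<close> leave open.\<close>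

definition wirt_deriv :: "(complex \<Rightarrow> complex) \<Rightarrow> complex \<Rightarrow> complex \<Rightarrow> complex \<Rightarrow> bool" where
  "wirt_deriv f p q z \<longleftrightarrow> (f has_derivative (\<lambda>t. p * t + q * cnj t)) (at z)"

lemma
  assumes "wirt_deriv f p q z"
  shows wirt_deriv_imp_wirt: "wirt f z = p" and wirt_deriv_imp_wirt_bar: "wirt_bar f z = q"
proof -
  have "frechet_derivative f (at z) = (\<lambda>t. p * t + q * cnj t)"
    using frechet_derivative_at[OF assms[unfolded wirt_deriv_def]] by simp
  then show "wirt f z = p" "wirt_bar f z = q"
    by (simp_all add: wirt_def wirt_bar_def algebra_simps)
qed

lemma wirt_deriv_const: "wirt_deriv (\<lambda>z. c) 0 0 z"
  unfolding wirt_deriv_def by simp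

lemma wirt_deriv_cnj: "wirt_deriv cnj 0 1 z"
  unfolding wirt_deriv_def by (auto intro!: derivative_eq_intros)

lemma wirt_deriv_add:
  assumes "wirt_deriv f p q z" "wirt_deriv g p' q' z"
  shows "wirt_deriv (\<lambda>z. f z + g z) (p + p') (q + q') z"
  unfolding wirt_deriv_def
  by (rule has_derivative_eq_rhs[OF has_derivative_add[OF assms[unfolded wirt_deriv_def]]])
     (auto simp: algebra_simps)

lemma wirt_deriv_mult:
  assumes "wirt_deriv f p q z" "wirt_deriv g p' q' z"
  shows "wirt_deriv (\<lambda>z. f z * g z) (p * g z + f z * p') (q * g z + f z * q') z"
  unfolding wirt_deriv_def
  by (rule has_derivative_eq_rhs[OF has_derivative_mult[OF assms[unfolded wirt_deriv_def]]])
     (auto simp: algebra_simps)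

lemma wirt_deriv_field:
  assumes "(f has_field_derivative p) (at z)"
  shows "wirt_deriv f p 0 z"
  using assms unfolding wirt_deriv_def has_field_derivative_def by simp

lemma wirt_deriv_compose:
  assumes "(\<phi> has_field_derivative d) (at (f z))" "wirt_deriv f p q z"
  shows "wirt_deriv (\<lambda>z. \<phi> (f z)) (d * p) (d * q) z"
  unfolding wirt_deriv_def
  by (rule has_derivative_eq_rhs[OF has_derivative_compose[OF assms(2)[unfolded wirt_deriv_def]
        assms(1)[unfolded has_field_derivative_def]]])
     (auto simp: algebra_simps)

lemma wirt_deriv_cong:
  assumes "wirt_deriv f p q z" "eventually (\<lambda>u. f u = g u) (nhds z)"
  shows "wirt_deriv g p q z"
  unfolding wirt_deriv_def
  by (rule has_derivative_transform_eventually[OF assms(1)[unfolded wirt_deriv_def]])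
     (use eventually_nhds_x_imp_x[OF assms(2)] assms(2) in
       \<open>auto simp: eventually_at_filter elim: eventually_mono\<close>)

text \<open>\<open>a0\<close>, \<open>a1\<close>, \<open>a2\<close> are the value and the first two derivatives in the conjugate variable at \<open>0\<close>;
  they multiply like truncated power series in \<open>cnj z\<close> with \<open>z\<close> set to \<open>0\<close>. Derivatives on a whole
  neighbourhood are required because the curvature has to be differentiated again.\<close>

definition bar_jet :: "(complex \<Rightarrow> complex) \<Rightarrow> complex \<Rightarrow> complex \<Rightarrow> complex \<Rightarrow> bool" where
  "bar_jet f a0 a1 a2 \<longleftrightarrow> f 0 = a0 \<and> (\<exists>p q p'.
     (\<forall>\<^sub>F z in nhds 0. wirt_deriv f (p z) (q z) z) \<and> q 0 = a1 \<and> wirt_deriv q p' a2 0)"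

lemma bar_jetI:
  assumes "\<forall>\<^sub>F z in nhds 0. wirt_deriv f (p z) (q z) z" "wirt_deriv q p' a2 0" "f 0 = a0" "q 0 = a1"
  shows "bar_jet f a0 a1 a2"
  using assms unfolding bar_jet_def by blast

lemma bar_jet_const: "bar_jet (\<lambda>z. c) c 0 0"
  by (rule bar_jetI[of _ "\<lambda>z. 0" "\<lambda>z. 0"]) (auto intro: wirt_deriv_const always_eventually)

lemma bar_jet_cnj: "bar_jet cnj 0 1 0"
  by (rule bar_jetI[of _ "\<lambda>z. 0" "\<lambda>z. 1"]) (auto intro: wirt_deriv_const wirt_deriv_cnj always_eventually)

lemma bar_jet_add:
  assumes "bar_jet f a0 a1 a2" "bar_jet g b0 b1 b2"
  shows "bar_jet (\<lambda>z. f z + g z) (a0 + b0) (a1 + b1) (a2 + b2)"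
proof -
  obtain p q p' where f: "f 0 = a0" "\<forall>\<^sub>F z in nhds 0. wirt_deriv f (p z) (q z) z" "q 0 = a1"
    "wirt_deriv q p' a2 0" using assms(1) unfolding bar_jet_def by blast
  obtain r s r' where g: "g 0 = b0" "\<forall>\<^sub>F z in nhds 0. wirt_deriv g (r z) (s z) z" "s 0 = b1"
    "wirt_deriv s r' b2 0" using assms(2) unfolding bar_jet_def by blast
  have "\<forall>\<^sub>F z in nhds 0. wirt_deriv (\<lambda>z. f z + g z) (p z + r z) (q z + s z) z"
    using f(2) g(2) by eventually_elim (rule wirt_deriv_add)
  then show ?thesis
    using f g wirt_deriv_add[OF f(4) g(4)] by (auto intro: bar_jetI)
qed

lemma bar_jet_mult:
  assumes "bar_jet f a0 a1 a2" "bar_jet g b0 b1 b2"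
  shows "bar_jet (\<lambda>z. f z * g z) (a0 * b0) (a1 * b0 + a0 * b1) (a2 * b0 + 2 * (a1 * b1) + a0 * b2)"
proof -
  obtain p q p' where f: "f 0 = a0" "\<forall>\<^sub>F z in nhds 0. wirt_deriv f (p z) (q z) z" "q 0 = a1"
    "wirt_deriv q p' a2 0" using assms(1) unfolding bar_jet_def by blast
  obtain r s r' where g: "g 0 = b0" "\<forall>\<^sub>F z in nhds 0. wirt_deriv g (r z) (s z) z" "s 0 = b1"
    "wirt_deriv s r' b2 0" using assms(2) unfolding bar_jet_def by blast
  have *: "\<forall>\<^sub>F z in nhds 0. wirt_deriv (\<lambda>z. f z * g z) (p z * g z + f z * r z) (q z * g z + f z * s z) z"
    using f(2) g(2) by eventually_elim (rule wirt_deriv_mult)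
  \<comment> \<open>The conjugate derivative of the product contains \<open>f\<close> and
    \<open>g\<close> themselves, so differentiating it once more also needs their first derivatives
    at 0.\<close>
  have f0: "wirt_deriv f (p 0) a1 0" and g0: "wirt_deriv g (r 0) b1 0"
    using eventually_nhds_x_imp_x[OF f(2)] eventually_nhds_x_imp_x[OF g(2)] f g by auto
  have "wirt_deriv (\<lambda>z. q z * g z + f z * s z)
      ((p' * g 0 + q 0 * r 0) + (p 0 * s 0 + f 0 * r')) ((a2 * g 0 + q 0 * b1) + (a1 * s 0 + f 0 * b2)) 0"
    by (intro wirt_deriv_add wirt_deriv_mult f g f0 g0)
  then have "bar_jet (\<lambda>z. f z * g z) (a0 * b0) (a1 * b0 + a0 * b1)
      ((a2 * g 0 + q 0 * b1) + (a1 * s 0 + f 0 * b2))"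
    using f g by (intro bar_jetI[OF *]) auto
  then show ?thesis
    using f g by (simp add: algebra_simps)
qed

lemma bar_jet_sum:
  assumes "finite I" "\<And>i. i \<in> I \<Longrightarrow> bar_jet (f i) (a i) (b i) (c i)"
  shows "bar_jet (\<lambda>z. \<Sum>i\<in>I. f i z) (sum a I) (sum b I) (sum c I)"
  using assms
proof (induction I rule: finite_induct)
  case empty
  show ?case using bar_jet_const[of 0] by simp
next
  case (insert i I)
  then show ?case using bar_jet_add[of "f i" "a i" "b i" "c i"] by simp
qed

lemma bar_jet_cong:
  assumes "bar_jet f a b c" "\<forall>\<^sub>F z in nhds 0. f z = g z"
  shows "bar_jet g a b c"
proof -
  obtain p q p' where f: "f 0 = a" "\<forall>\<^sub>F z in nhds 0. wirt_deriv f (p z) (q z) z" "q 0 = b"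
    "wirt_deriv q p' c 0" using assms(1) unfolding bar_jet_def by blast
  \<comment> \<open>Agreement near 0 is agreement near every point close to 0, so the derivatives
    agree on a neighbourhood and not just at 0.\<close>
  have "\<forall>\<^sub>F z in nhds 0. \<forall>\<^sub>F u in nhds z. f u = g u"
    using assms(2) by (simp add: eventually_eventually)
  then have "\<forall>\<^sub>F z in nhds 0. wirt_deriv g (p z) (q z) z"
    using f(2) by eventually_elim (rule wirt_deriv_cong)
  then show ?thesis
    by (rule bar_jetI) (use f eventually_nhds_x_imp_x[OF assms(2)] in auto)
qed

text \<open>The conjugate derivative vanishes identically near 0, hence so does its own
  derivative.\<close>

lemma bar_jet_holomorphic:
  assumes "f analytic_on {0}"
  shows "bar_jet f (f 0) 0 0"
proof -
  obtain S where "open S" "0 \<in> S" "f holomorphic_on S"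
    using assms analytic_at by blast
  then have "\<forall>\<^sub>F z in nhds 0. wirt_deriv f (deriv f z) 0 z"
    by (auto simp: eventually_nhds intro!: exI[of _ S] wirt_deriv_field holomorphic_derivI)
  then show ?thesis
    by (rule bar_jetI[where q = "\<lambda>z. 0"]) (auto intro: wirt_deriv_const)
qed

lemma eventually_wirt_deriv_radial:
  assumes "\<phi> analytic_on {0}"
  shows "\<forall>\<^sub>F z in nhds 0. wirt_deriv (\<lambda>z. \<phi> (z * cnj z)) (deriv \<phi> (z * cnj z) * cnj z)
           (deriv \<phi> (z * cnj z) * z) z"
proof -
  obtain S where S: "open S" "0 \<in> S" "\<phi> holomorphic_on S"
    using assms analytic_at by blast
  have "((\<lambda>z::complex. z * cnj z) \<longlongrightarrow> 0 * cnj 0) (nhds 0)"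
    by (intro tendsto_intros filterlim_ident)
  then have "\<forall>\<^sub>F z::complex in nhds 0. z * cnj z \<in> S"
    using S(1,2) by (simp add: topological_tendstoD)
  then show ?thesis
  proof eventually_elim
    case (elim z)
    have "wirt_deriv (\<lambda>z. z * cnj z) (1 * cnj z + z * 0) (0 * cnj z + z * 1) z"
      by (intro wirt_deriv_mult wirt_deriv_cnj wirt_deriv_field) (auto intro!: derivative_eq_intros)
    then show ?case
      using wirt_deriv_compose[of \<phi> _ "\<lambda>z. z * cnj z", OF holomorphic_derivI[OF S(3,1) elim]]
      by simp
  qed
qed

text \<open>The conjugate derivative is \<open>deriv \<phi> (z * cnj z) * z\<close>. The factor
  \<open>z\<close> vanishes at 0 and has no conjugate derivative, so with \<open>z\<close> set to 0
  a radial function looks constant.\<close>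

lemma bar_jet_radial:
  assumes "\<phi> analytic_on {0}"
  shows "bar_jet (\<lambda>z. \<phi> (z * cnj z)) (\<phi> 0) 0 0"
proof -
  have "deriv \<phi> analytic_on {0}"
    using assms by (rule analytic_deriv)
  then have "wirt_deriv (\<lambda>z. deriv \<phi> (z * cnj z)) 0 0 0"
    using eventually_nhds_x_imp_x[OF eventually_wirt_deriv_radial] by simp
  then have "wirt_deriv (\<lambda>z. deriv \<phi> (z * cnj z) * z) (0 * 0 + deriv \<phi> (0 * cnj 0) * 1)
      (0 * 0 + deriv \<phi> (0 * cnj 0) * 0) 0"
    by (rule wirt_deriv_mult) (auto intro: wirt_deriv_field)
  then show ?thesis
    by (intro bar_jetI[OF eventually_wirt_deriv_radial[OF assms]]) auto
qed

section \<open>Jets and z-derivatives of matrix-valued functions\<close>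

definition mat_jet :: "(complex \<Rightarrow> complex^'n^'m) \<Rightarrow> complex^'n^'m \<Rightarrow> complex^'n^'m \<Rightarrow> complex^'n^'m \<Rightarrow> bool"
  where "mat_jet F A0 A1 A2 \<longleftrightarrow>
    (\<forall>i j. bar_jet (\<lambda>z. F z $ i $ j) (A0 $ i $ j) (A1 $ i $ j) (A2 $ i $ j))"

lemma mat_jet_const: "mat_jet (\<lambda>z. A) A 0 0"
  unfolding mat_jet_def by (simp add: bar_jet_const)

lemma mat_jet_add:
  assumes "mat_jet F A0 A1 A2" "mat_jet G B0 B1 B2"
  shows "mat_jet (\<lambda>z. F z + G z) (A0 + B0) (A1 + B1) (A2 + B2)"
  using assms unfolding mat_jet_def by (simp add: bar_jet_add)

lemma mat_jet_mult:
  assumes "mat_jet F A0 A1 A2" "mat_jet G B0 B1 B2"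
  shows "mat_jet (\<lambda>z. F z ** G z) (A0 ** B0) (A1 ** B0 + A0 ** B1)
    (A2 ** B0 + 2 *\<^sub>R (A1 ** B1) + A0 ** B2)"
  unfolding mat_jet_def
proof (intro allI)
  fix i j
  have "bar_jet (\<lambda>z. \<Sum>k\<in>UNIV. F z $ i $ k * G z $ k $ j) (\<Sum>k\<in>UNIV. A0 $ i $ k * B0 $ k $ j)
    (\<Sum>k\<in>UNIV. A1 $ i $ k * B0 $ k $ j + A0 $ i $ k * B1 $ k $ j)
    (\<Sum>k\<in>UNIV. A2 $ i $ k * B0 $ k $ j + 2 * (A1 $ i $ k * B1 $ k $ j) + A0 $ i $ k * B2 $ k $ j)"
    using assms unfolding mat_jet_def by (intro bar_jet_sum bar_jet_mult) auto
  then show "bar_jet (\<lambda>z. (F z ** G z) $ i $ j) ((A0 ** B0) $ i $ j) ((A1 ** B0 + A0 ** B1) $ i $ j)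
     ((A2 ** B0 + 2 *\<^sub>R (A1 ** B1) + A0 ** B2) $ i $ j)"
    by (simp add: matrix_matrix_mult_def sum.distrib sum_distrib_left scaleR_conv_of_real)
qed

lemma mat_jet_cong:
  assumes "mat_jet F A B C" "\<forall>\<^sub>F z in nhds 0. F z = G z"
  shows "mat_jet G A B C"
  unfolding mat_jet_def
proof (intro allI)
  fix i j
  have "\<forall>\<^sub>F z in nhds 0. F z $ i $ j = G z $ i $ j"
    using assms(2) by eventually_elim simp
  then show "bar_jet (\<lambda>z. G z $ i $ j) (A $ i $ j) (B $ i $ j) (C $ i $ j)"
    using assms(1) by (auto simp: mat_jet_def intro: bar_jet_cong[where f = "\<lambda>z. F z $ i $ j"])
qed

text \<open>The curvature is one conjugate derivative of
  \<open>matrix_inv (h u) ** mat_wirt h u\<close> and its covariant derivative is a second one, so a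
  jet of that product contains both.\<close>

lemma curvature_from_jet:
  assumes "mat_jet (\<lambda>u. matrix_inv (h u) ** mat_wirt h u) A0 A1 A2"
  shows "curvature h 0 = A1" "curvature_zbar h 0 = A2"
proof -
  define \<theta> where "\<theta> u = matrix_inv (h u) ** mat_wirt h u" for u
  have cur: "curvature h z $ i $ j = wirt_bar (\<lambda>u. \<theta> u $ i $ j) z" for z i j
    by (simp add: curvature_def mat_wirt_bar_def \<theta>_def)
  have "curvature h 0 $ i $ j = A1 $ i $ j \<and> curvature_zbar h 0 $ i $ j = A2 $ i $ j" for i j
  proof -
    obtain p q p' where q: "\<forall>\<^sub>F z in nhds 0. wirt_deriv (\<lambda>u. \<theta> u $ i $ j) (p z) (q z) z"
      "q 0 = A1 $ i $ j" "wirt_deriv q p' (A2 $ i $ j) 0"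
      using assms unfolding mat_jet_def bar_jet_def \<theta>_def by blast
    \<comment> \<open>The first conjugate derivative is the curvature on a whole neighbourhood, so
      the derivative of \<open>q\<close> at 0 transfers to it.\<close>
    have ev: "\<forall>\<^sub>F z in nhds 0. q z = curvature h z $ i $ j"
      using q(1) by eventually_elim (simp add: cur wirt_deriv_imp_wirt_bar)
    then show ?thesis
      using eventually_nhds_x_imp_x[OF ev] q wirt_deriv_imp_wirt_bar[OF wirt_deriv_cong[OF q(3) ev]]
      by (simp add: curvature_zbar_def mat_wirt_bar_def)
  qed
  then show "curvature h 0 = A1" "curvature_zbar h 0 = A2"
    by (simp_all add: vec_eq_iff)
qed

text \<open>Only the value of the z-derivative is fixed, since it is what \<open>mat_wirt\<close>
  returns; the existential keeps real differentiability of each entry. Conjugate derivatives are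
  read off later from the jet of the resulting closed formula.\<close>

definition mat_dz :: "(complex \<Rightarrow> complex^'n^'m) \<Rightarrow> complex^'n^'m \<Rightarrow> complex \<Rightarrow> bool" where
  "mat_dz F A z \<longleftrightarrow> (\<forall>i j. \<exists>q. wirt_deriv (\<lambda>u. F u $ i $ j) (A $ i $ j) q z)"

lemma mat_dz_imp_mat_wirt: "mat_dz F A z \<Longrightarrow> mat_wirt F z = A"
  unfolding mat_dz_def mat_wirt_def vec_eq_iff by (auto dest: wirt_deriv_imp_wirt)

lemma wirt_deriv_sum:
  assumes "finite I" "\<And>i. i \<in> I \<Longrightarrow> wirt_deriv (f i) (p i) (q i) z"
  shows "wirt_deriv (\<lambda>z. \<Sum>i\<in>I. f i z) (sum p I) (sum q I) z"
  using assms
proof (induction I rule: finite_induct)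
  case empty
  show ?case using wirt_deriv_const[of 0] by simp
next
  case (insert i I)
  then show ?case using wirt_deriv_add[of "f i" "p i" "q i"] by simp
qed

lemma mat_dz_mult:
  assumes "mat_dz F A z" "mat_dz G B z"
  shows "mat_dz (\<lambda>z. F z ** G z) (A ** G z + F z ** B) z"
  unfolding mat_dz_def
proof (intro allI)
  fix i j
  have "\<forall>k. \<exists>q. wirt_deriv (\<lambda>u. F u $ i $ k) (A $ i $ k) q z"
    "\<forall>k. \<exists>q. wirt_deriv (\<lambda>u. G u $ k $ j) (B $ k $ j) q z"
    using assms unfolding mat_dz_def by auto
  then obtain a b where ab: "\<And>k. wirt_deriv (\<lambda>u. F u $ i $ k) (A $ i $ k) (a k) z"
    "\<And>k. wirt_deriv (\<lambda>u. G u $ k $ j) (B $ k $ j) (b k) z"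
    by (auto dest!: choice)
  have "wirt_deriv (\<lambda>z. \<Sum>k\<in>UNIV. F z $ i $ k * G z $ k $ j)
     (\<Sum>k\<in>UNIV. A $ i $ k * G z $ k $ j + F z $ i $ k * B $ k $ j)
     (\<Sum>k\<in>UNIV. a k * G z $ k $ j + F z $ i $ k * b k) z"
    by (intro wirt_deriv_sum wirt_deriv_mult ab) auto
  then show "\<exists>q. wirt_deriv (\<lambda>u. (F u ** G u) $ i $ j) ((A ** G z + F z ** B) $ i $ j) q z"
    by (auto simp: matrix_matrix_mult_def sum.distrib)
qed

lemma mat_dz_holomorphic:
  assumes "\<And>i j. ((\<lambda>u. F u $ i $ j) has_field_derivative A $ i $ j) (at z)"
  shows "mat_dz F A z"
  unfolding mat_dz_def using assms wirt_deriv_field by blast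

lemma mat_dz_antiholomorphic:
  assumes "\<And>i j. ((\<lambda>u. F u $ i $ j) has_field_derivative A $ i $ j) (at (cnj z))"
  shows "mat_dz (\<lambda>z. F (cnj z)) 0 z"
  unfolding mat_dz_def using wirt_deriv_compose[OF assms wirt_deriv_cnj] by fastforce

section \<open>Radial diagonal factors and exponentials of weighted shifts\<close>

definition diag_radial :: "(complex \<Rightarrow> complex) \<Rightarrow> (complex \<Rightarrow> complex) \<Rightarrow> (complex \<Rightarrow> complex) \<Rightarrow> complex \<Rightarrow> complex^3^3"
  where "diag_radial f g k z = diag3 (f (z * cnj z)) (g (z * cnj z)) (k (z * cnj z))"

lemma diag3_nth:
  "diag3 a b c $ 1 $ 1 = a" "diag3 a b c $ 1 $ 2 = 0" "diag3 a b c $ 1 $ 3 = 0"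
  "diag3 a b c $ 2 $ 1 = 0" "diag3 a b c $ 2 $ 2 = b" "diag3 a b c $ 2 $ 3 = 0"
  "diag3 a b c $ 3 $ 1 = 0" "diag3 a b c $ 3 $ 2 = 0" "diag3 a b c $ 3 $ 3 = c"
  by (simp_all add: diag3_def)

lemma mat_jet_diag3:
  assumes "bar_jet a a0 a1 a2" "bar_jet b b0 b1 b2" "bar_jet c c0 c1 c2"
  shows "mat_jet (\<lambda>z. diag3 (a z) (b z) (c z)) (diag3 a0 b0 c0) (diag3 a1 b1 c1) (diag3 a2 b2 c2)"
  using assms unfolding mat_jet_def by (simp add: forall_3 diag3_nth bar_jet_const)

lemma diag3_0: "diag3 0 0 0 = 0"
  by (simp add: vec_eq_iff forall_3 diag3_nth)

lemma diag3_1: "diag3 1 1 1 = mat 1"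
  by (simp add: vec_eq_iff forall_3 diag3_nth mat_def)

lemma diag3_mult: "diag3 a b c ** diag3 a' b' c' = diag3 (a * a') (b * b') (c * c')"
  by (simp add: vec_eq_iff forall_3 diag3_nth matrix_matrix_mult_def sum_3)

lemma mat_jet_diag_radial:
  assumes "f analytic_on {0}" "g analytic_on {0}" "k analytic_on {0}"
  shows "mat_jet (diag_radial f g k) (diag3 (f 0) (g 0) (k 0)) 0 0"
  using mat_jet_diag3[OF assms[THEN bar_jet_radial]] by (simp add: diag_radial_def[abs_def] diag3_0)

text \<open>The chain rule factor \<open>cnj z\<close> is kept as a separate scalar matrix, so that
  \<open>mat_jet_mult\<close> can treat it as a factor with jet \<open>0\<close>,
  \<open>mat 1\<close>, \<open>0\<close>.\<close>

lemma eventually_mat_dz_diag_radial: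
  assumes "f analytic_on {0}" "g analytic_on {0}" "k analytic_on {0}"
  shows "\<forall>\<^sub>F z in nhds 0. mat_dz (diag_radial f g k)
    (diag_radial (deriv f) (deriv g) (deriv k) z ** mat (cnj z)) z"
  using assms[THEN eventually_wirt_deriv_radial]
  by eventually_elim
     (auto simp: mat_dz_def forall_3 diag_radial_def diag3_nth matrix_matrix_mult_def sum_3 mat_def
       intro: wirt_deriv_const)

lemma eventually_diag_radial_inverse:
  assumes "f analytic_on {0}" "g analytic_on {0}" "k analytic_on {0}"
    and "f 0 \<noteq> 0" "g 0 \<noteq> 0" "k 0 \<noteq> 0"
  shows "\<forall>\<^sub>F z in nhds 0. diag_radial f g k z **
    diag_radial (\<lambda>x. inverse (f x)) (\<lambda>x. inverse (g x)) (\<lambda>x. inverse (k x)) z = mat 1"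
proof -
  have *: "\<forall>\<^sub>F z in nhds 0. f (z * cnj z) \<noteq> 0" if "f analytic_on {0}" "f 0 \<noteq> 0" for f
  proof -
    have "isCont f (0 * cnj 0)"
      using that(1) by (simp add: analytic_at_imp_isCont)
    then have "((\<lambda>z. f (z * cnj z)) \<longlongrightarrow> f (0 * cnj 0)) (nhds 0)"
      by (rule isCont_tendsto_compose) (intro tendsto_intros filterlim_ident)
    then show ?thesis
      using that(2) by (intro tendsto_imp_eventually_ne[of _ "f 0"]) auto
  qed
  show ?thesis
    using *[OF assms(1,4)] *[OF assms(2,5)] *[OF assms(3,6)]
    by eventually_elim (simp add: diag_radial_def diag3_mult diag3_1)
qed

text \<open>This is the exponential of \<open>z\<close> times the weighted shift
  \<open>shift \<alpha> \<beta>\<close>, whose cube is zero, so the series stops at the quadratic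
  term.\<close>

definition shift_exp :: "complex \<Rightarrow> complex \<Rightarrow> complex \<Rightarrow> complex^3^3" where
  "shift_exp \<alpha> \<beta> z = vector [vector [1, 0, 0], vector [\<alpha> * z, 1, 0], vector [\<alpha> * \<beta> * z\<^sup>2 / 2, \<beta> * z, 1]]"

definition shift :: "complex \<Rightarrow> complex \<Rightarrow> complex^3^3" where
  "shift \<alpha> \<beta> = vector [vector [0, 0, 0], vector [\<alpha>, 0, 0], vector [0, \<beta>, 0]]"

lemmas mat3_simps = vec_eq_iff forall_3 diag3_nth matrix_matrix_mult_def sum_3 mat_def
  shift_exp_def shift_def transpose_def

lemma shift_exp_mult_minus: "shift_exp \<alpha> \<beta> z ** shift_exp \<alpha> \<beta> (- z) = mat 1"
  by (simp add: mat3_simps power2_eq_square algebra_simps)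

lemma shift_exp_has_derivative:
  "((\<lambda>z. shift_exp \<alpha> \<beta> z $ i $ j) has_field_derivative (shift \<alpha> \<beta> ** shift_exp \<alpha> \<beta> z) $ i $ j) (at z)"
proof -
  have "\<forall>i j. ((\<lambda>z. shift_exp \<alpha> \<beta> z $ i $ j) has_field_derivative
      (shift \<alpha> \<beta> ** shift_exp \<alpha> \<beta> z) $ i $ j) (at z)"
    by (auto simp: mat3_simps intro!: derivative_eq_intros)
  then show ?thesis by blast
qed

lemma mat_jet_shift_exp: "mat_jet (shift_exp \<alpha> \<beta>) (mat 1) 0 0"
proof -
  have "bar_jet (\<lambda>z. \<alpha> * z) 0 0 0" for \<alpha>
    using bar_jet_holomorphic[of "\<lambda>z. \<alpha> * z"] by (auto intro: analytic_intros)
  moreover have "bar_jet (\<lambda>z. \<alpha> * \<beta> * z\<^sup>2 / 2) 0 0 0"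
    using bar_jet_holomorphic[of "\<lambda>z. \<alpha> * \<beta> * z\<^sup>2 / 2"]
    by (simp add: analytic_on_mult analytic_on_power analytic_on_ident analytic_on_divide)
  ultimately show ?thesis
    unfolding mat_jet_def by (simp add: mat3_simps bar_jet_const)
qed

text \<open>With T the transposed shift and w = \<open>cnj z\<close>, exp (c w T) has derivatives c
  T and c^2 T^2 in w at 0, and c^2 = 1 for both signs.\<close>

lemma mat_jet_shift_exp_cnj:
  assumes "c = 1 \<or> c = -1"
  shows "mat_jet (\<lambda>z. transpose (shift_exp \<alpha> \<beta> (c * cnj z))) (mat 1) (mat c ** transpose (shift \<alpha> \<beta>))
    (transpose (shift \<alpha> \<beta>) ** transpose (shift \<alpha> \<beta>))"
proof -
  have 1: "bar_jet (\<lambda>z. \<alpha> * (c * cnj z)) 0 (\<alpha> * c) 0" for \<alpha>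
    using bar_jet_mult[OF bar_jet_const[of "\<alpha> * c"] bar_jet_cnj] by (simp add: mult.assoc)
  have 2: "bar_jet (\<lambda>z. \<alpha> * \<beta> * (c * cnj z)\<^sup>2 / 2) 0 0 (\<alpha> * \<beta>)"
    using bar_jet_mult[OF bar_jet_mult[OF bar_jet_const[of "\<alpha> * \<beta> / 2"] bar_jet_cnj] bar_jet_cnj] assms
    by (auto simp: power2_eq_square algebra_simps)
  show ?thesis
    unfolding mat_jet_def using 1[of \<alpha>] 1[of \<beta>] 2
    by (simp add: mat3_simps bar_jet_const mult.commute)
qed

section \<open>Elementary matrix algebra\<close>

lemma matrix_inv_unique_right:
  fixes A B :: "'a::field^'n^'n"
  assumes "A ** B = mat 1"
  shows "matrix_inv A = B"
proof -
  have "B ** A = mat 1" using assms matrix_left_right_inverse by blast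
  then have "invertible A" using assms unfolding invertible_def by blast
  then have "matrix_inv A ** A = mat 1"
    by (metis (mono_tags, lifting) invertible_def matrix_inv_def someI_ex)
  then show ?thesis using assms by (metis matrix_mul_assoc matrix_mul_lid matrix_mul_rid)
qed

lemma matrix_mult_zero: "A ** 0 = 0" "0 ** B = 0"
  by (simp_all add: vec_eq_iff matrix_matrix_mult_def)

lemma matrix_add_rdistrib: "(A + B) ** C = A ** C + B ** (C :: 'a::semiring_1^'n^'m)"
  by (simp add: vec_eq_iff matrix_matrix_mult_def distrib_right sum.distrib)

subsection \<open>Curvature of a metric in product form\<close>

lemma mat_jet_eq:
  "mat_jet F A B C \<Longrightarrow> A = A' \<Longrightarrow> B = B' \<Longrightarrow> C = C' \<Longrightarrow> mat_jet F A' B' C'"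
  by simp

lemma mat_jet_mat_cnj: "mat_jet (\<lambda>z. mat (cnj z)) 0 (mat 1 :: complex^'n^'n) 0"
  unfolding mat_jet_def mat_def using bar_jet_cnj bar_jet_const by simp

text \<open>Set z to 0 and write w for \<open>cnj z\<close>. The metric becomes the identity,
  because its two antiholomorphic exponentials cancel, so the connection form has the jet of the
  z-derivative of the metric, which is exp (-w T) (w N + A) exp (w T) + w M - A. Its first two
  derivatives in w at 0 are the two formulas; the term w M is linear and leaves no trace in the
  second.\<close>

lemma curvature_model:
  fixes f0 f1 f2 g0 g1 g2 :: "complex \<Rightarrow> complex" and \<alpha> \<beta> :: complex
  defines "X \<equiv> diag_radial f0 f1 f2" and "Y \<equiv> diag_radial g0 g1 g2"
    and "E \<equiv> shift_exp \<alpha> \<beta>" and "A \<equiv> shift \<alpha> \<beta>" and "T \<equiv> transpose (shift \<alpha> \<beta>)"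
    and "N \<equiv> diag3 (deriv f0 0) (deriv f1 0) (deriv f2 0)"
    and "M \<equiv> diag3 (deriv g0 0) (deriv g1 0) (deriv g2 0)"
  assumes an: "f0 analytic_on {0}" "f1 analytic_on {0}" "f2 analytic_on {0}"
    "g0 analytic_on {0}" "g1 analytic_on {0}" "g2 analytic_on {0}"
    and one: "f0 0 = 1" "f1 0 = 1" "f2 0 = 1" "g0 0 = 1" "g1 0 = 1" "g2 0 = 1"
    and h: "\<forall>\<^sub>F z in nhds 0. h z =
      transpose (E (- cnj z)) ** X z ** E z ** transpose (E (cnj z)) ** Y z ** E (- z)"
  shows "curvature h 0 = N + M + (A ** T - T ** A)"
    and "curvature_zbar h 0 = 2 *\<^sub>R (N ** T - T ** N) + (T ** T ** A - 2 *\<^sub>R (T ** A ** T) + A ** T ** T)"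
proof -
  define h0 where
    "h0 z = transpose (E (- cnj z)) ** X z ** E z ** transpose (E (cnj z)) ** Y z ** E (- z)" for z
  define X' where "X' = diag_radial (deriv f0) (deriv f1) (deriv f2)"
  define Y' where "Y' = diag_radial (deriv g0) (deriv g1) (deriv g2)"
  define Xi where "Xi = diag_radial (\<lambda>x. inverse (f0 x)) (\<lambda>x. inverse (f1 x)) (\<lambda>x. inverse (f2 x))"
  define Yi where "Yi = diag_radial (\<lambda>x. inverse (g0 x)) (\<lambda>x. inverse (g1 x)) (\<lambda>x. inverse (g2 x))"
  \<comment> \<open>The factors of \<open>h0\<close> inverted in reverse order; an exponential is
    inverted by changing the sign of its argument.\<close>
  define hi where
    "hi z = E z ** Yi z ** transpose (E (- cnj z)) ** E (- z) ** Xi z ** transpose (E (cnj z))" for z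
  \<comment> \<open>Leibniz rule in z: \<open>X z\<close>, \<open>E z\<close>, \<open>Y z\<close>
    and \<open>E (- z)\<close> contribute one term each, while the exponentials in
    \<open>cnj z\<close> have z-derivative 0.\<close>
  define dh where "dh z =
      transpose (E (- cnj z)) ** (X' z ** mat (cnj z)) ** E z ** transpose (E (cnj z)) ** Y z ** E (- z) +
      transpose (E (- cnj z)) ** X z ** (A ** E z) ** transpose (E (cnj z)) ** Y z ** E (- z) +
      transpose (E (- cnj z)) ** X z ** E z ** transpose (E (cnj z)) ** (Y' z ** mat (cnj z)) ** E (- z) +
      transpose (E (- cnj z)) ** X z ** E z ** transpose (E (cnj z)) ** Y z ** ((- A) ** E (- z))" for z
  have EE: "E z ** E (- z) = mat 1" "E (- z) ** E z = mat 1" for z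
    using shift_exp_mult_minus[of \<alpha> \<beta>] shift_exp_mult_minus[of \<alpha> \<beta> "- z"] by (auto simp: E_def)
  have TT: "transpose (E z) ** transpose (E (- z)) = mat 1" "transpose (E (- z)) ** transpose (E z) = mat 1" for z
    using EE by (metis matrix_transpose_mul transpose_mat)+
  have inv: "\<forall>\<^sub>F z in nhds 0. matrix_inv (h0 z) = hi z"
  proof -
    have "\<forall>\<^sub>F z in nhds 0. X z ** Xi z = mat 1" "\<forall>\<^sub>F z in nhds 0. Y z ** Yi z = mat 1"
      unfolding X_def Xi_def Y_def Yi_def using an one by (auto intro!: eventually_diag_radial_inverse)
    then show ?thesis
    proof eventually_elim
      case (elim z)
      \<comment> \<open>Cancellation for products nested to the right; \<open>h0 z ** hi z\<close>
        then collapses from the middle outwards.\<close>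
      have *: "B ** (C ** D) = D" if "B ** C = mat 1" for B C D :: "complex^3^3"
        using that by (simp add: matrix_mul_assoc)
      have "h0 z ** hi z = mat 1"
        by (simp add: h0_def hi_def matrix_mul_assoc[symmetric] elim[THEN *] EE[THEN *] TT[THEN *] TT)
      then show ?case by (rule matrix_inv_unique_right)
    qed
  qed
  have dz: "\<forall>\<^sub>F z in nhds 0. mat_dz h0 (dh z) z"
  proof -
    have "\<forall>\<^sub>F z in nhds 0. mat_dz X (X' z ** mat (cnj z)) z"
      "\<forall>\<^sub>F z in nhds 0. mat_dz Y (Y' z ** mat (cnj z)) z"
      unfolding X_def X'_def Y_def Y'_def using an by (auto intro!: eventually_mat_dz_diag_radial)
    then show ?thesis
    proof eventually_elim
      case (elim z)
      have d: "((\<lambda>z. E z $ i $ j) has_field_derivative (A ** E z) $ i $ j) (at z)" for z i j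
        unfolding E_def A_def by (rule shift_exp_has_derivative)
      have minus: "(uminus has_field_derivative -1) (at z)" for z :: complex
        by (rule DERIV_minus[OF DERIV_ident])
      have E1: "mat_dz E (A ** E z) z"
        by (intro mat_dz_holomorphic d)
      have E2: "mat_dz (\<lambda>z. E (- z)) ((- A) ** E (- z)) z"
      proof (rule mat_dz_holomorphic)
        fix i j
        show "((\<lambda>z. E (- z) $ i $ j) has_field_derivative ((- A) ** E (- z)) $ i $ j) (at z)"
          using DERIV_chain2[where f = "\<lambda>z. E z $ i $ j" and g = uminus and x = z and s = UNIV and Db = "-1",
              OF d minus]
          by (simp add: matrix_matrix_mult_def sum_negf)
      qed
      have E3: "mat_dz (\<lambda>z. transpose (E (cnj z))) 0 z"
        by (rule mat_dz_antiholomorphic[of "\<lambda>z. transpose (E z)" "transpose (A ** E (cnj z))"])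
           (simp add: transpose_def d)
      have E4: "mat_dz (\<lambda>z. transpose (E (- cnj z))) 0 z"
      proof (rule mat_dz_antiholomorphic[of "\<lambda>z. transpose (E (- z))" "- transpose (A ** E (- cnj z))"])
        fix i j
        show "((\<lambda>u. transpose (E (- u)) $ i $ j) has_field_derivative (- transpose (A ** E (- cnj z))) $ i $ j)
          (at (cnj z))"
          using DERIV_chain2[where f = "\<lambda>z. E z $ j $ i" and g = uminus and x = "cnj z" and s = UNIV
              and Db = "-1", OF d minus]
          by (simp add: transpose_def)
      qed
      show ?case
        using mat_dz_mult[OF mat_dz_mult[OF mat_dz_mult[OF mat_dz_mult[OF mat_dz_mult[OF E4 elim(1)] E1] E3] elim(2)] E2]
        by (simp add: h0_def[abs_def] dh_def matrix_add_rdistrib algebra_simps)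
    qed
  qed
  have JE: "mat_jet E (mat 1) 0 0"
    unfolding E_def by (rule mat_jet_shift_exp)
  have JEm: "mat_jet (\<lambda>z. E (- z)) (mat 1) 0 0"
  proof -
    \<comment> \<open>Negating the argument amounts to negating both weights; the quadratic entry is
      the same either way.\<close>
    have "shift_exp \<alpha> \<beta> (- z) = shift_exp (- \<alpha>) (- \<beta>) z" for z
      by (simp add: mat3_simps)
    then show ?thesis unfolding E_def using mat_jet_shift_exp[of "- \<alpha>" "- \<beta>"] by simp
  qed
  have JT: "mat_jet (\<lambda>z. transpose (E (cnj z))) (mat 1) T (T ** T)"
    "mat_jet (\<lambda>z. transpose (E (- cnj z))) (mat 1) (- T) (T ** T)"
  proof -
    have "mat (- 1) ** T = - T"
      by (simp add: mat3_simps T_def)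
    then show "mat_jet (\<lambda>z. transpose (E (cnj z))) (mat 1) T (T ** T)"
      "mat_jet (\<lambda>z. transpose (E (- cnj z))) (mat 1) (- T) (T ** T)"
      using mat_jet_shift_exp_cnj[of 1 \<alpha> \<beta>] mat_jet_shift_exp_cnj[of "-1" \<alpha> \<beta>]
      by (simp_all add: E_def T_def)
  qed
  have inv_an: "(\<lambda>x. inverse (f x)) analytic_on {0}" if "f analytic_on {0}" "f 0 = 1"
    for f :: "complex \<Rightarrow> complex"
    using that by (auto intro: analytic_on_inverse)
  have JX: "mat_jet X (mat 1) 0 0" "mat_jet X' N 0 0" "mat_jet Xi (mat 1) 0 0"
    "mat_jet Y (mat 1) 0 0" "mat_jet Y' M 0 0" "mat_jet Yi (mat 1) 0 0"
    using mat_jet_diag_radial[OF an(1-3)] mat_jet_diag_radial[OF an(4-6)]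
      mat_jet_diag_radial[OF an(1-3)[THEN analytic_deriv]]
      mat_jet_diag_radial[OF an(4-6)[THEN analytic_deriv]]
      mat_jet_diag_radial[OF inv_an[OF an(1) one(1)] inv_an[OF an(2) one(2)] inv_an[OF an(3) one(3)]]
      mat_jet_diag_radial[OF inv_an[OF an(4) one(4)] inv_an[OF an(5) one(5)] inv_an[OF an(6) one(6)]]
    by (simp_all add: X_def X'_def Xi_def Y_def Y'_def Yi_def N_def M_def one diag3_1)
  note J = JE JEm JT JX mat_jet_mat_cnj mat_jet_const
  \<comment> \<open>With z set to 0 only the transposed exponentials remain, and their jets cancel:
    -T + T = 0 and T^2 - 2 T^2 + T^2 = 0.\<close>
  have Jhi: "mat_jet hi (mat 1) 0 0"
    unfolding hi_def
    by (rule mat_jet_eq, (rule mat_jet_mult J)+, simp_all add: mat3_simps T_def scaleR_conv_of_real)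
  have Jdh: "mat_jet dh 0 (N + M + (A ** T - T ** A))
    (2 *\<^sub>R (N ** T - T ** N) + (T ** T ** A - 2 *\<^sub>R (T ** A ** T) + A ** T ** T))"
    unfolding dh_def
    by (rule mat_jet_eq, (rule mat_jet_add mat_jet_mult J)+,
        simp_all add: mat3_simps T_def A_def N_def M_def scaleR_conv_of_real algebra_simps)
  have "mat_jet (\<lambda>z. hi z ** dh z) 0 (N + M + (A ** T - T ** A))
    (2 *\<^sub>R (N ** T - T ** N) + (T ** T ** A - 2 *\<^sub>R (T ** A ** T) + A ** T ** T))"
    using mat_jet_mult[OF Jhi Jdh] by (simp add: matrix_mult_zero)
  moreover have "\<forall>\<^sub>F z in nhds 0. hi z ** dh z = matrix_inv (h z) ** mat_wirt h z"
  proof -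
    have "\<forall>\<^sub>F z in nhds 0. \<forall>\<^sub>F u in nhds z. h u = h0 u"
      using h by (simp add: eventually_eventually h0_def)
    then show ?thesis using inv dz h
    proof eventually_elim
      case (elim z)
      have "mat_dz h (dh z) z"
        unfolding mat_dz_def
      proof (intro allI)
        fix i j
        obtain q where "wirt_deriv (\<lambda>u. h0 u $ i $ j) (dh z $ i $ j) q z"
          using elim(3) unfolding mat_dz_def by blast
        then have "wirt_deriv (\<lambda>u. h u $ i $ j) (dh z $ i $ j) q z"
          by (rule wirt_deriv_cong) (use elim(1) in \<open>auto elim: eventually_mono\<close>)
        then show "\<exists>q. wirt_deriv (\<lambda>u. h u $ i $ j) (dh z $ i $ j) q z" ..
      qed
      then show ?case
        using elim(2,4) by (simp add: mat_dz_imp_mat_wirt h0_def)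
    qed
  qed
  ultimately have "mat_jet (\<lambda>z. matrix_inv (h z) ** mat_wirt h z) 0 (N + M + (A ** T - T ** A))
    (2 *\<^sub>R (N ** T - T ** N) + (T ** T ** A - 2 *\<^sub>R (T ** A ** T) + A ** T ** T))"
    by (rule mat_jet_cong)
  then show "curvature h 0 = N + M + (A ** T - T ** A)"
    "curvature_zbar h 0 = 2 *\<^sub>R (N ** T - T ** N) + (T ** T ** A - 2 *\<^sub>R (T ** A ** T) + A ** T ** T)"
    by (rule curvature_from_jet)+
qed

subsection \<open>The normalized metric of the homogeneous kernel\<close>

lemma mat_power_Suc: "mat_power A (Suc k) = A ** mat_power A k"
  by (simp add: mat_power_def)

lemma mat_power_0: "mat_power A 0 = mat 1"
  by (simp add: mat_power_def)

lemma mat_exp_cube_zero: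
  assumes "mat_power A 3 = 0"
  shows "mat_exp A = mat 1 + A + (1/2) *\<^sub>R (A ** A)"
proof -
  have z: "mat_power A (k + 3) = 0" for k
  proof (induction k)
    case 0
    show ?case using assms by simp
  next
    case (Suc k)
    show ?case
      by (simp only: add_Suc mat_power_Suc Suc matrix_mult_zero)
  qed
  have "mat_power A k = 0" if "k \<notin> {0, 1, 2}" for k
  proof -
    have "(k - 3) + 3 = k" using that by auto
    then show ?thesis using z[of "k - 3"] by (simp only:)
  qed
  then have "mat_exp A = (\<Sum>k\<in>{0, 1, 2}. (1 / fact k) *\<^sub>R mat_power A k)"
    unfolding mat_exp_def by (intro suminf_finite) auto
  moreover have "mat_power A 1 = A" "mat_power A 2 = A ** A"
    by (simp_all add: mat_power_def numeral_2_eq_2)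
  ultimately show ?thesis
    by (simp add: mat_power_0)
qed

lemma mat_power_3: "mat_power A 3 = A ** (A ** A)"
  by (simp add: mat_power_def numeral_3_eq_3)

lemma mat_exp_Smat: "mat_exp (mat_scale z Smat) = shift_exp 1 2 z"
proof -
  have S: "mat_scale z Smat = shift z (2 * z)"
    by (simp add: mat3_simps mat_scale_def map_matrix_def Smat_def)
  have "mat_power (shift z (2 * z)) 3 = 0"
    by (simp add: mat_power_3 mat3_simps)
  show ?thesis
    unfolding S mat_exp_cube_zero[OF \<open>mat_power _ 3 = 0\<close>]
    by (simp add: scaleR_conv_of_real[where 'a = complex] mat3_simps power2_eq_square)
qed

lemma mat_exp_Smat_adjoint: "mat_exp (mat_scale z (mat_adjoint Smat)) = transpose (shift_exp 1 2 z)"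
proof -
  have S: "mat_scale z (mat_adjoint Smat) = transpose (shift z (2 * z))"
    by (simp add: mat3_simps mat_scale_def map_matrix_def mat_adjoint_def Smat_def)
  have "mat_power (transpose (shift z (2 * z))) 3 = 0"
    by (simp add: mat_power_3 mat3_simps)
  show ?thesis
    unfolding S mat_exp_cube_zero[OF \<open>mat_power _ 3 = 0\<close>]
    by (simp add: scaleR_conv_of_real[where 'a = complex] mat3_simps power2_eq_square)
qed

section \<open>Square roots of positive diagonal matrices\<close>

lemma mat_psd_diag3:
  assumes "0 \<le> a" "0 \<le> b" "0 \<le> c"
  shows "mat_psd (diag3 (of_real a) (of_real b) (of_real c))"
proof -
  have "Re (of_real r * u * cnj u) \<ge> 0" if "r \<ge> 0" for r u
  proof -
    have "of_real r * u * cnj u = of_real (r * (cmod u)\<^sup>2)"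
      by (simp only: mult.assoc complex_norm_square[symmetric] of_real_mult)
    then show ?thesis using that by (simp only: Re_complex_of_real) simp
  qed
  then show ?thesis
    unfolding mat_psd_def using assms
    by (simp add: mat_adjoint_def map_matrix_def mat3_simps cinner_def matrix_vector_mult_def)
qed

text \<open>\<open>mat_sqrt\<close> is a definite description, so the point is uniqueness. A
  positive semidefinite root R commutes with its square, hence with the diagonal root Q, so (R + Q)
  (R - Q) = 0; as Q is positive definite, R + Q is injective.\<close>

lemma mat_sqrt_diag3:
  assumes "0 < a" "0 < b" "0 < c"
  shows "mat_sqrt (diag3 (of_real a) (of_real b) (of_real c)) =
    diag3 (of_real (sqrt a)) (of_real (sqrt b)) (of_real (sqrt c))" (is "mat_sqrt ?B = ?Q")
  unfolding mat_sqrt_def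
proof (rule the_equality)
  have sq: "complex_of_real (sqrt r) * complex_of_real (sqrt r) = complex_of_real r" if "r > 0" for r
    using that by (simp flip: of_real_mult)
  have QQ: "?Q ** ?Q = ?B"
    using assms by (simp add: diag3_mult sq)
  then show "mat_psd ?Q \<and> ?Q ** ?Q = ?B"
    using assms by (simp add: mat_psd_diag3)
  fix R assume R: "mat_psd R \<and> R ** R = ?B"
  have comm: "R ** ?B = ?B ** R"
    using R matrix_mul_assoc[of R R R] by simp
  \<comment> \<open>Entrywise form of commuting with a diagonal matrix: an entry can be nonzero only
    where the two diagonal values, and so their roots, coincide.\<close>
  have "u * complex_of_real (sqrt r) = complex_of_real (sqrt s) * u"
    if "u * complex_of_real r = complex_of_real s * u" for u r s
    using that by (cases "u = 0") (simp_all add: mult.commute)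
  then have "R ** ?Q = ?Q ** R"
    using comm by (simp add: mat3_simps)
  show "R = ?Q"
  proof (rule ccontr)
    assume "R \<noteq> ?Q"
    then obtain x where x: "R *v x \<noteq> ?Q *v x"
      unfolding matrix_eq by blast
    define y where "y = R *v x - ?Q *v x"
    \<comment> \<open>As R and Q commute, the sum expands to (R R - Q Q) x, and both squares are the
      same matrix.\<close>
    have "R *v y + ?Q *v y = 0"
      unfolding y_def using R QQ \<open>R ** ?Q = ?Q ** R\<close>
      by (simp add: matrix_vector_mult_diff_distrib matrix_vector_mul_assoc)
    then have "cinner (R *v y + ?Q *v y) y = 0"
      by (simp add: cinner_def)
    then have "cinner (R *v y) y + cinner (?Q *v y) y = 0"
      by (simp add: cinner_def distrib_right sum.distrib)
    then have "Re (cinner (R *v y) y) + Re (cinner (?Q *v y) y) = 0"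
      by (simp flip: plus_complex.sel(1))
    moreover have "Re (cinner (R *v y) y) \<ge> 0"
      using R by (simp add: mat_psd_def)
    moreover have "Re (cinner (?Q *v y) y) = sqrt a * (cmod (y $ 1))\<^sup>2 + sqrt b * (cmod (y $ 2))\<^sup>2
        + sqrt c * (cmod (y $ 3))\<^sup>2"
    proof -
      have "u * cnj u = (complex_of_real (cmod u))\<^sup>2" for u
        by (simp flip: complex_norm_square)
      then have "cinner (?Q *v y) y = of_real (sqrt a * (cmod (y $ 1))\<^sup>2 + sqrt b * (cmod (y $ 2))\<^sup>2
        + sqrt c * (cmod (y $ 3))\<^sup>2)"
        by (simp add: mat3_simps cinner_def matrix_vector_mult_def mult.assoc)
      then show ?thesis by (simp only: Re_complex_of_real)
    qed
    moreover have "y \<noteq> 0"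
      using x by (simp add: y_def)
    then have "y $ 1 \<noteq> 0 \<or> y $ 2 \<noteq> 0 \<or> y $ 3 \<noteq> 0"
      by (auto simp: vec_eq_iff forall_3)
    then have "sqrt a * (cmod (y $ 1))\<^sup>2 > 0 \<or> sqrt b * (cmod (y $ 2))\<^sup>2 > 0 \<or> sqrt c * (cmod (y $ 3))\<^sup>2 > 0"
      using assms by auto
    moreover have "sqrt a * (cmod (y $ 1))\<^sup>2 \<ge> 0" "sqrt b * (cmod (y $ 2))\<^sup>2 \<ge> 0" "sqrt c * (cmod (y $ 3))\<^sup>2 \<ge> 0"
      using assms by auto
    ultimately show False by linarith
  qed
qed

lemma transpose_diag3: "transpose (diag3 a b c) = diag3 a b c"
  by (simp add: mat3_simps)

lemma mat_scale_diag3: "mat_scale s (diag3 a b c) = diag3 (s * a) (s * b) (s * c)"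
  by (simp add: mat3_simps mat_scale_def map_matrix_def)

lemma mat_scale_mult_left: "mat_scale s (A ** B) = mat_scale s A ** B"
  by (simp add: vec_eq_iff mat_scale_def map_matrix_def matrix_matrix_mult_def sum_distrib_left mult.assoc)

text \<open>Since \<open>K z 0 = B ** transpose (F z)\<close> and
  \<open>K 0 w = F (cnj w) ** B\<close>, normalizing inserts exponentials of opposite sign.
  Conjugating by the root Q of B turns \<open>F\<close> into \<open>E = Qi ** F ** Q\<close>, which
  absorbs B; transposition reverses the order of the factors.\<close>

lemma kernel_metric_Kker:
  assumes d: "dcoef lam \<mu> 0 = 1" "dcoef lam \<mu> (Suc 0) > 0" "dcoef lam \<mu> 2 > 0"
  defines "p \<equiv> \<lambda>x. (1 - x) powr complex_of_real (- 2 * lam - 2)"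
    and "E \<equiv> shift_exp (of_real (1 / sqrt (dcoef lam \<mu> 1)))
      (of_real (2 * sqrt (dcoef lam \<mu> 1) / sqrt (dcoef lam \<mu> 2)))"
  shows "kernel_metric (Kker lam \<mu>) z = transpose (E (- cnj z)) **
     diag_radial (\<lambda>x. (1 - x)\<^sup>2) (\<lambda>x. 1 - x) (\<lambda>x. 1) z ** E z ** transpose (E (cnj z)) **
     diag_radial (\<lambda>x. p x * (1 - x)\<^sup>2) (\<lambda>x. p x * (1 - x)) p z ** E (- z)"
proof -
  define d1 d2 where "d1 = dcoef lam \<mu> 1" and "d2 = dcoef lam \<mu> 2"
  have pos: "d1 > 0" "d2 > 0" using d by (simp_all add: d1_def d2_def)
  define q1 q2 where "q1 = complex_of_real (sqrt d1)" and "q2 = complex_of_real (sqrt d2)"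
  have nz: "q1 \<noteq> 0" "q2 \<noteq> 0" and sq: "complex_of_real d1 = q1 * q1" "complex_of_real d2 = q2 * q2"
    using pos by (simp_all add: q1_def q2_def flip: of_real_mult)
  define F where "F = shift_exp 1 2"
  define Q Qi B Bi where "Q = diag3 1 q1 q2" and "Qi = diag3 1 (1 / q1) (1 / q2)"
    and "B = diag3 1 (q1 * q1) (q2 * q2)" and "Bi = diag3 1 (1 / (q1 * q1)) (1 / (q2 * q2))"
  have QQ: "Q ** Qi = mat 1" "Qi ** Q = mat 1" "Q ** Q = B" "Qi ** Qi = Bi" "B ** Bi = mat 1"
    "Bi ** B = mat 1" "Qi ** B = Q" "B ** Qi = Q" "Bi ** Q = Qi" "Q ** Bi = Qi"
    using nz by (simp_all add: Q_def Qi_def B_def Bi_def diag3_mult flip: diag3_1)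
  have B: "Bmat lam \<mu> = B"
    using d sq by (simp add: Bmat_def B_def d1_def d2_def)
  have FF: "F u ** F (- u) = mat 1" "F (- u) ** F u = mat 1" for u
    using shift_exp_mult_minus[of 1 2 u] shift_exp_mult_minus[of 1 2 "- u"] by (simp_all add: F_def)
  have TT: "transpose (F u) ** transpose (F (- u)) = mat 1" "transpose (F (- u)) ** transpose (F u) = mat 1" for u
    using FF by (metis matrix_transpose_mul transpose_mat)+
  have F0: "F 0 = mat 1" by (simp add: F_def mat3_simps)
  have D0: "Dmat 0 = mat 1" by (simp add: Dmat_def flip: diag3_1)
  \<comment> \<open>The scalar power is attached to the left \<open>Dmat\<close> only; after
    transposition it sits in the right radial factor.\<close>
  have K: "Kker lam \<mu> z w = mat_scale (p (z * cnj w)) (Dmat (z * cnj w)) ** F (cnj w) ** B **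
      transpose (F z) ** Dmat (z * cnj w)" for z w
    by (simp add: Kker_def p_def B mat_exp_Smat mat_exp_Smat_adjoint F_def mat_scale_mult_left)
  have p0: "p 0 = 1" by (simp add: p_def)
  have s1: "mat_scale 1 A = A" for A :: "complex^3^3"
    by (simp add: vec_eq_iff mat_scale_def map_matrix_def)
  have "Kker lam \<mu> z 0 = B ** transpose (F z)" "Kker lam \<mu> 0 z = F (cnj z) ** B"
    "Kker lam \<mu> 0 0 = B"
    by (simp_all add: K p0 D0 F0 s1)
  moreover have "matrix_inv (B ** transpose (F z)) = transpose (F (- z)) ** Bi"
    by (rule matrix_inv_unique_right) (metis QQ(5) TT(1) matrix_mul_assoc matrix_mul_rid)
  moreover have "matrix_inv (F (cnj z) ** B) = Bi ** F (- cnj z)"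
    by (rule matrix_inv_unique_right) (metis QQ(5) FF(1) matrix_mul_assoc matrix_mul_rid)
  moreover have "mat_sqrt B = Q"
    using mat_sqrt_diag3[of 1 d1 d2] pos sq by (simp add: B_def Q_def q1_def q2_def)
  ultimately have "normalized_kernel (Kker lam \<mu>) z z = Q ** (transpose (F (- z)) ** Bi) **
      (mat_scale (p (z * cnj z)) (Dmat (z * cnj z)) ** F (cnj z) ** B ** transpose (F z) ** Dmat (z * cnj z)) **
      (Bi ** F (- cnj z)) ** Q"
    by (simp add: normalized_kernel_def K)
  then have 1: "kernel_metric (Kker lam \<mu>) z = Q ** transpose (F (- cnj z)) ** Bi ** Dmat (z * cnj z) ** F z ** B **
     transpose (F (cnj z)) ** mat_scale (p (z * cnj z)) (Dmat (z * cnj z)) ** Bi ** F (- z) ** Q"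
    by (simp add: kernel_metric_def matrix_transpose_mul matrix_mul_assoc Dmat_def mat_scale_diag3
       transpose_diag3 Q_def B_def Bi_def)
  have 2: "E u = Qi ** F u ** Q" for u
    using nz by (simp add: E_def F_def Q_def Qi_def mat3_simps q1_def q2_def d1_def d2_def)
  have 3: "transpose (E u) = Q ** transpose (F u) ** Qi" for u
    by (simp add: 2 matrix_transpose_mul matrix_mul_assoc) (simp add: Q_def Qi_def transpose_diag3)
  define X Y where "X = Dmat (z * cnj z)" and "Y = mat_scale (p (z * cnj z)) (Dmat (z * cnj z))"
  have X: "diag_radial (\<lambda>x. (1 - x)\<^sup>2) (\<lambda>x. 1 - x) (\<lambda>x. 1) z = X"
    "diag_radial (\<lambda>x. p x * (1 - x)\<^sup>2) (\<lambda>x. p x * (1 - x)) p z = Y"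
    by (simp_all add: X_def Y_def diag_radial_def Dmat_def mat_scale_diag3)
  \<comment> \<open>Diagonal matrices commute, so each \<open>Bi\<close> splits into two
    \<open>Qi\<close> around a radial factor. Together with \<open>B = Q ** Q\<close> this gives
    every exponential the two factors that turn it into an \<open>E\<close> or its
    transpose.\<close>
  have XB: "Qi ** X ** Qi = Bi ** X" "Qi ** Y ** Qi = Y ** Bi"
    using nz by (simp_all add: X_def Y_def Qi_def Bi_def Dmat_def mat_scale_diag3 diag3_mult)
  have "kernel_metric (Kker lam \<mu>) z = Q ** transpose (F (- cnj z)) ** (Qi ** X ** Qi) ** F z ** (Q ** Q) **
     transpose (F (cnj z)) ** (Qi ** Y ** Qi) ** F (- z) ** Q"
    unfolding XB QQ(3) by (simp add: 1 X_def Y_def matrix_mul_assoc)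
  then show ?thesis
    unfolding X 3 by (simp add: 2 matrix_mul_assoc)
qed

subsection \<open>Uniqueness of the Hilbert space of a kernel\<close>

lemma complex_inner_spaceD:
  assumes "complex_inner_space H ip"
  shows cis_zero: "(\<lambda>z. 0) \<in> H"
    and cis_add: "\<And>f g. f \<in> H \<Longrightarrow> g \<in> H \<Longrightarrow> (\<lambda>z. f z + g z) \<in> H"
    and cis_scale: "\<And>c f. f \<in> H \<Longrightarrow> (\<lambda>z. c *s f z) \<in> H"
    and cis_ip_add: "\<And>f g k. f \<in> H \<Longrightarrow> g \<in> H \<Longrightarrow> k \<in> H \<Longrightarrow> ip (\<lambda>z. f z + g z) k = ip f k + ip g k"
    and cis_ip_scale: "\<And>c f g. f \<in> H \<Longrightarrow> g \<in> H \<Longrightarrow> ip (\<lambda>z. c *s f z) g = c * ip f g"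
    and cis_ip_cnj: "\<And>f g. f \<in> H \<Longrightarrow> g \<in> H \<Longrightarrow> ip g f = cnj (ip f g)"
    and cis_ip_pos: "\<And>f. f \<in> H \<Longrightarrow> f \<noteq> (\<lambda>z. 0) \<Longrightarrow> 0 < Re (ip f f)"
  using assms unfolding complex_inner_space_def by blast+

context
  fixes H :: "(complex \<Rightarrow> complex^'n) set" and ip
  assumes cis: "complex_inner_space H ip"
begin

lemma cis_ip_zero: "f \<in> H \<Longrightarrow> ip (\<lambda>z. 0) f = 0"
  using cis_ip_scale[OF cis, of "\<lambda>z. 0" f 0] cis_zero[OF cis] by simp

lemma cis_ip_nonneg: "f \<in> H \<Longrightarrow> 0 \<le> Re (ip f f)"
  using cis_ip_pos[OF cis, of f] cis_ip_zero[of f] by fastforce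

lemma cis_diff: "f \<in> H \<Longrightarrow> g \<in> H \<Longrightarrow> (\<lambda>z. f z - g z) \<in> H"
  using cis_add[OF cis, of f "\<lambda>z. (-1) *s g z"] cis_scale[OF cis, of g "-1"] by simp

lemma cis_ip_diff: "f \<in> H \<Longrightarrow> g \<in> H \<Longrightarrow> k \<in> H \<Longrightarrow> ip (\<lambda>z. f z - g z) k = ip f k - ip g k"
  using cis_ip_add[OF cis, of f "\<lambda>z. (-1) *s g z" k] cis_scale[OF cis, of g "-1"]
    cis_ip_scale[OF cis, of g k "-1"] by simp

lemma cis_ip_add_right: "f \<in> H \<Longrightarrow> g \<in> H \<Longrightarrow> k \<in> H \<Longrightarrow> ip k (\<lambda>z. f z + g z) = ip k f + ip k g"
  using cis_ip_cnj[OF cis, of "\<lambda>z. f z + g z" k] cis_add[OF cis, of f g] cis_ip_add[OF cis, of f g k]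
    cis_ip_cnj[OF cis, of f k] cis_ip_cnj[OF cis, of g k] by simp

lemma cis_ip_diff_right: "f \<in> H \<Longrightarrow> g \<in> H \<Longrightarrow> k \<in> H \<Longrightarrow> ip k (\<lambda>z. f z - g z) = ip k f - ip k g"
  using cis_ip_cnj[OF cis, of "\<lambda>z. f z - g z" k] cis_diff[of f g] cis_ip_diff[of f g k]
    cis_ip_cnj[OF cis, of f k] cis_ip_cnj[OF cis, of g k] by simp

lemma cis_ip_scale_right: "f \<in> H \<Longrightarrow> g \<in> H \<Longrightarrow> ip g (\<lambda>z. c *s f z) = cnj c * ip g f"
  using cis_ip_cnj[OF cis, of "\<lambda>z. c *s f z" g] cis_scale[OF cis, of f c] cis_ip_scale[OF cis, of f g c]
    cis_ip_cnj[OF cis, of f g] by simp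

lemma cis_norm_diff_scale:
  assumes "f \<in> H" "k \<in> H"
  shows "Re (ip (\<lambda>z. f z - c *s k z) (\<lambda>z. f z - c *s k z)) =
    Re (ip f f) - 2 * Re (cnj c * ip f k) + (cmod c)\<^sup>2 * Re (ip k k)"
proof -
  have ck: "(\<lambda>z. c *s k z) \<in> H" using cis_scale[OF cis] assms by blast
  have "ip (\<lambda>z. f z - c *s k z) (\<lambda>z. f z - c *s k z) =
      ip f f - cnj c * ip f k - (c * cnj (ip f k) - c * (cnj c * ip k k))"
    using assms ck cis_ip_diff[OF assms(1) ck cis_diff[OF assms(1) ck]]
    by (simp add: cis_ip_diff_right cis_ip_scale_right cis_ip_scale[OF cis] flip: cis_ip_cnj[OF cis, of f k])
  moreover have "Re (c * cnj (ip f k)) = Re (cnj c * ip f k)"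
    by simp
  moreover have "Re (c * (cnj c * ip k k)) = (cmod c)\<^sup>2 * Re (ip k k)"
    by (simp only: mult.assoc[symmetric] complex_norm_square[symmetric]) simp
  ultimately show ?thesis by simp
qed

text \<open>The case \<open>e = 0\<close> is the Cauchy-Schwarz inequality. With \<open>e\<close> the squared distance of a vector to a
  subspace, it says that an almost closest point leaves an almost orthogonal remainder.\<close>

lemma cis_cauchy_schwarz:
  assumes "f \<in> H" "k \<in> H" and pos: "\<And>c. e \<le> Re (ip (\<lambda>z. f z - c *s k z) (\<lambda>z. f z - c *s k z))"
  shows "(cmod (ip f k))\<^sup>2 \<le> (Re (ip f f) - e) * Re (ip k k)"
proof (cases "Re (ip k k) = 0")
  case True
  then have "k = (\<lambda>z. 0)" using cis_ip_pos[OF cis assms(2)] by fastforce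
  then have "ip f k = 0"
    using cis_ip_zero[OF assms(1)] cis_ip_cnj[OF cis, of k f] assms by simp
  then show ?thesis using True by simp
next
  case False
  define N where "N = Re (ip k k)"
  have N: "N > 0" using False cis_ip_nonneg[OF assms(2)] by (simp add: N_def)
  \<comment> \<open>The coefficient of the orthogonal projection of \<open>f\<close> onto
    \<open>k\<close>, which minimizes the distance.\<close>
  define c where "c = ip f k / of_real N"
  have "cnj c * ip f k = of_real ((cmod (ip f k))\<^sup>2 / N)"
    unfolding c_def of_real_divide complex_norm_square by simp
  then have "Re (cnj c * ip f k) = (cmod (ip f k))\<^sup>2 / N"
    by (simp only: Re_complex_of_real)
  moreover have "(cmod c)\<^sup>2 * N = (cmod (ip f k))\<^sup>2 / N"
    using N by (simp add: c_def norm_divide power_divide power2_eq_square)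
  ultimately have "e \<le> Re (ip f f) - (cmod (ip f k))\<^sup>2 / N"
    using pos[of c] cis_norm_diff_scale[OF assms(1,2), of c] by (simp flip: N_def)
  then have "(cmod (ip f k))\<^sup>2 / N \<le> Re (ip f f) - e" by simp
  then show ?thesis using N by (simp add: pos_divide_le_eq N_def)
qed

lemma cis_ip_diff_le:
  assumes "f \<in> H" "g \<in> H" "k \<in> H"
  shows "cmod (ip f k - ip g k) \<le> ip_dist ip f g * sqrt (Re (ip k k))"
proof -
  have d: "(\<lambda>z. f z - g z) \<in> H" using cis_diff assms by blast
  have "(cmod (ip (\<lambda>z. f z - g z) k))\<^sup>2 \<le>
      (Re (ip (\<lambda>z. f z - g z) (\<lambda>z. f z - g z)) - 0) * Re (ip k k)"
  proof (rule cis_cauchy_schwarz[OF d assms(3)])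
    fix c
    show "0 \<le> Re (ip (\<lambda>z. (f z - g z) - c *s k z) (\<lambda>z. (f z - g z) - c *s k z))"
      using cis_ip_nonneg cis_diff[OF d cis_scale[OF cis assms(3)]] by blast
  qed
  then show ?thesis
    unfolding ip_dist_def cis_ip_diff[OF assms] real_sqrt_mult[symmetric] by (simp add: real_le_rsqrt)
qed

lemma cis_ip_tendsto:
  assumes "\<And>n. F n \<in> H" "f \<in> H" "k \<in> H" "(\<lambda>n. ip_dist ip (F n) f) \<longlonglongrightarrow> 0"
  shows "(\<lambda>n. ip (F n) k) \<longlonglongrightarrow> ip f k" "(\<lambda>n. ip k (F n)) \<longlonglongrightarrow> ip k f"
proof -
  have "(\<lambda>n. ip (F n) k - ip f k) \<longlonglongrightarrow> 0"
  proof (rule Lim_null_comparison)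
    show "(\<lambda>n. ip_dist ip (F n) f * sqrt (Re (ip k k))) \<longlonglongrightarrow> 0"
      using tendsto_mult_left_zero[OF assms(4)] .
  qed (use cis_ip_diff_le[OF assms(1,2,3)] in auto)
  then show 1: "(\<lambda>n. ip (F n) k) \<longlonglongrightarrow> ip f k" by (simp add: LIM_zero_iff)
  show "(\<lambda>n. ip k (F n)) \<longlonglongrightarrow> ip k f"
    using tendsto_cnj[OF 1] cis_ip_cnj[OF cis, of _ k] assms(1-3) by simp
qed

text \<open>Parallelogram law for u = f - g and v = f - h: the difference v - u is g - h, and half
  of u + v is f minus the midpoint of g and h.\<close>

lemma cis_parallelogram:
  assumes "f \<in> H" "g \<in> H" "h \<in> H"
  shows "(ip_dist ip g h)\<^sup>2 = 2 * (ip_dist ip f g)\<^sup>2 + 2 * (ip_dist ip f h)\<^sup>2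
    - 4 * (ip_dist ip f (\<lambda>z. (1/2) *s (g z + h z)))\<^sup>2"
proof -
  have d: "(\<lambda>z. f z - g z) \<in> H" "(\<lambda>z. f z - h z) \<in> H" using cis_diff assms by blast+
  have sq: "(ip_dist ip u v)\<^sup>2 = Re (ip (\<lambda>z. u z - v z) (\<lambda>z. u z - v z))" if "u \<in> H" "v \<in> H" for u v
    unfolding ip_dist_def using cis_diff[OF that] cis_ip_nonneg by simp
  have m: "(\<lambda>z. (1/2) *s (g z + h z)) \<in> H"
    using cis_scale[OF cis cis_add[OF cis assms(2,3)]] .
  define u v where "u = (\<lambda>z. f z - g z)" and "v = (\<lambda>z. f z - h z)"
  have uv: "u \<in> H" "v \<in> H" using d by (simp_all add: u_def v_def)
  have 1: "(\<lambda>z. g z - h z) = (\<lambda>z. v z - 1 *s u z)"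
    by (simp add: u_def v_def)
  have 2: "(\<lambda>z. f z - (1/2) *s (g z + h z)) = (\<lambda>z. (1/2) *s (v z - (-1) *s u z))"
    by (rule ext) (simp add: u_def v_def vec_eq_iff algebra_simps)
  have w: "(\<lambda>z. v z - (-1) *s u z) \<in> H"
    using cis_diff[OF uv(2) cis_scale[OF cis uv(1)]] .
  have 3: "ip (\<lambda>z. (1/2) *s (v z - (-1) *s u z)) (\<lambda>z. (1/2) *s (v z - (-1) *s u z)) =
     (1/4) * ip (\<lambda>z. v z - (-1) *s u z) (\<lambda>z. v z - (-1) *s u z)"
    using cis_ip_scale[OF cis w cis_scale[OF cis w]] cis_ip_scale_right[OF w w] by simp
  show ?thesis
    unfolding sq[OF assms(2,3)] sq[OF assms(1,2)] sq[OF assms(1,3)] sq[OF assms(1) m] 1 2 3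
    using cis_norm_diff_scale[OF uv(2,1), of 1] cis_norm_diff_scale[OF uv(2,1), of "-1"]
    by (simp add: field_simps flip: u_def v_def)
qed

end

section \<open>The span of the kernel sections and its density\<close>

inductive_set kernel_span :: "(complex \<Rightarrow> complex \<Rightarrow> complex^'n^'n) \<Rightarrow> (complex \<Rightarrow> complex^'n) set"
  for K where
  zero: "(\<lambda>z. 0) \<in> kernel_span K"
| step: "f \<in> kernel_span K \<Longrightarrow> w \<in> ball 0 1 \<Longrightarrow> (\<lambda>z. f z + c *s kernel_section K w x z) \<in> kernel_span K"

lemma kernel_span_add:
  assumes "f \<in> kernel_span K" "g \<in> kernel_span K"
  shows "(\<lambda>z. f z + g z) \<in> kernel_span K"
  using assms(2)
proof induction
  case zero
  show ?case using assms(1) by simp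
next
  case (step g w c x)
  then show ?case using kernel_span.step[of "\<lambda>z. f z + g z" K w c x] by (simp add: add.assoc)
qed

lemma kernel_span_scale:
  assumes "f \<in> kernel_span K"
  shows "(\<lambda>z. a *s f z) \<in> kernel_span K"
  using assms
proof induction
  case zero
  show ?case using kernel_span.zero by simp
next
  case (step g w c x)
  then show ?case using kernel_span.step[of "\<lambda>z. a *s g z" K w "a * c" x]
    by (simp add: vector_add_ldistrib)
qed

lemma rkhsD:
  assumes "rkhs K H ip"
  shows rkhs_cis: "complex_inner_space H ip"
    and rkhs_complete: "\<And>F. (\<And>n. F n \<in> H) \<Longrightarrow>
       (\<And>e. e > 0 \<Longrightarrow> \<exists>N. \<forall>m\<ge>N. \<forall>n\<ge>N. ip_dist ip (F m) (F n) < e) \<Longrightarrow>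
        (\<exists>f\<in>H. (\<lambda>n. ip_dist ip (F n) f) \<longlonglongrightarrow> 0)"
    and rkhs_outside: "\<And>f z. f \<in> H \<Longrightarrow> z \<notin> ball 0 1 \<Longrightarrow> f z = 0"
    and rkhs_section: "\<And>w x. w \<in> ball 0 1 \<Longrightarrow> kernel_section K w x \<in> H"
    and rkhs_reproducing: "\<And>f w x. f \<in> H \<Longrightarrow> w \<in> ball 0 1 \<Longrightarrow>
       ip f (kernel_section K w x) = cinner (f w) x"
  using assms unfolding rkhs_def hilbert_function_space_def by blast+

lemma rkhs_kernel_span:
  assumes "rkhs K H ip"
  shows "kernel_span K \<subseteq> H"
proof
  fix f assume "f \<in> kernel_span K"
  then show "f \<in> H"
  proof induction
    case zero
    show ?case using cis_zero[OF rkhs_cis[OF assms]] .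
  next
    case (step f w c x)
    then show ?case
      using cis_add[OF rkhs_cis[OF assms] step(3) cis_scale[OF rkhs_cis[OF assms] rkhs_section[OF assms step(2)]]]
      by simp
  qed
qed

text \<open>Pairing with a section is evaluation, the same in both spaces; conjugate linearity in
  the second argument extends this along the span.\<close>

lemma rkhs_ip_kernel_span_eq:
  assumes "rkhs K H ip" "rkhs K H' ip'" "f \<in> H" "f \<in> H'" "g \<in> kernel_span K"
  shows "ip f g = ip' f g"
  using assms(5)
proof induction
  case zero
  show ?case
    using cis_ip_cnj[OF rkhs_cis[OF assms(1)] cis_zero[OF rkhs_cis[OF assms(1)]] assms(3)]
      cis_ip_cnj[OF rkhs_cis[OF assms(2)] cis_zero[OF rkhs_cis[OF assms(2)]] assms(4)]
      cis_ip_zero[OF rkhs_cis[OF assms(1)] assms(3)] cis_ip_zero[OF rkhs_cis[OF assms(2)] assms(4)]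
    by simp
next
  case (step g w c x)
  have *: "i f (\<lambda>z. g z + c *s kernel_section K w x z) = i f g + cnj c * cinner (f w) x"
    if "rkhs K G i" "f \<in> G" for G i
  proof -
    note cs = rkhs_cis[OF that(1)] and s = rkhs_section[OF that(1) step(2), of x]
    have "g \<in> G" using rkhs_kernel_span[OF that(1)] step(1) by blast
    then show ?thesis
      using cis_ip_add_right[OF cs _ cis_scale[OF cs s] that(2)] cis_ip_scale_right[OF cs s that(2)]
        rkhs_reproducing[OF that step(2)] by simp
  qed
  show ?case using *[OF assms(1,3)] *[OF assms(2,4)] step(3) by simp
qed

lemma cinner_eqI:
  assumes "\<And>x. cinner u x = cinner v x"
  shows "u = v"
proof -
  have "cinner w (axis i 1) = w $ i" for w :: "complex^'a" and i
    by (simp add: cinner_def axis_def if_distrib cong: if_cong)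
  then show ?thesis using assms by (metis vec_eq_iff)
qed

text \<open>By the reproducing property norm convergence forces convergence of the values, which
  determines the norm limit inside the disc; outside both functions vanish. As \<open>f\<close> is
  not assumed to lie in \<open>H\<close>, this is how membership passes from one space to
  another.\<close>

lemma rkhs_eq_of_pointwise_limit:
  assumes "rkhs K H ip" "\<And>n. F n \<in> H" "g \<in> H" "(\<lambda>n. ip_dist ip (F n) g) \<longlonglongrightarrow> 0"
    and "\<And>w x. w \<in> ball 0 1 \<Longrightarrow> (\<lambda>n. cinner (F n w) x) \<longlonglongrightarrow> cinner (f w) x"
    and "\<And>z. z \<notin> ball 0 1 \<Longrightarrow> f z = 0"
  shows "f = g"
proof
  fix w
  show "f w = g w"
  proof (cases "w \<in> ball 0 1")
    case True
    show ?thesis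
    proof (rule cinner_eqI)
      fix x
      have "(\<lambda>n. ip (F n) (kernel_section K w x)) \<longlonglongrightarrow> ip g (kernel_section K w x)"
        using assms rkhs_section[OF assms(1) True] by (intro cis_ip_tendsto[OF rkhs_cis[OF assms(1)]]) auto
      then have "(\<lambda>n. cinner (F n w) x) \<longlonglongrightarrow> cinner (g w) x"
        using rkhs_reproducing[OF assms(1) _ True] assms(2,3) by simp
      then show "cinner (f w) x = cinner (g w) x"
        using assms(5)[OF True] LIMSEQ_unique by blast
    qed
  next
    case False
    then show ?thesis using assms(6) rkhs_outside[OF assms(1,3)] by simp
  qed
qed

text \<open>Take a sequence in the span along which the squared distance to \<open>f\<close> tends
  to its infimum. It is Cauchy by the parallelogram law, and its remainders are almost orthogonal to
  every section, so its values tend to those of \<open>f\<close> and its norm limit is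
  \<open>f\<close>.\<close>

lemma kernel_span_dense:
  assumes R: "rkhs K H ip" and f: "f \<in> H"
  shows "\<exists>F. (\<forall>n. F n \<in> kernel_span K) \<and> (\<lambda>n. ip_dist ip (F n) f) \<longlonglongrightarrow> 0"
proof -
  note cs = rkhs_cis[OF R]
  have sub: "g \<in> H" if "g \<in> kernel_span K" for g using rkhs_kernel_span[OF R] that by blast
  define D where "D = (\<lambda>g. (ip_dist ip f g)\<^sup>2) ` kernel_span K"
  define d where "d = Inf D"
  have D: "D \<noteq> {}" "bdd_below D"
    unfolding D_def using kernel_span.zero by (auto intro: bdd_belowI[of _ 0])
  have dle: "d \<le> (ip_dist ip f g)\<^sup>2" if "g \<in> kernel_span K" for g
    unfolding d_def by (rule cInf_lower) (use that D in \<open>auto simp: D_def\<close>)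
  have "\<exists>g\<in>kernel_span K. (ip_dist ip f g)\<^sup>2 < d + 1 / real (Suc n)" for n
  proof -
    have "Inf D < d + 1 / real (Suc n)" by (simp add: d_def)
    then show ?thesis using cInf_less_iff[OF D] by (auto simp: D_def)
  qed
  then obtain F where F: "\<And>n. F n \<in> kernel_span K" "\<And>n. (ip_dist ip f (F n))\<^sup>2 < d + 1 / real (Suc n)"
    by metis
  have FH: "F n \<in> H" for n using sub F by blast
  have cauchy: "\<exists>N. \<forall>m\<ge>N. \<forall>n\<ge>N. ip_dist ip (F m) (F n) < e" if "e > 0" for e
  proof -
    \<comment> \<open>The midpoint stays in the span, so the parallelogram law bounds the squared
      distance by 2 (d + 1/(m+1)) + 2 (d + 1/(n+1)) - 4 d, which is at most 4/(N+1) for m, n \<ge>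
      N.\<close>
    obtain N where N: "4 / real (Suc N) < e\<^sup>2"
      using reals_Archimedean[of "e\<^sup>2 / 4"] \<open>e > 0\<close> by (auto simp: field_simps)
    have "ip_dist ip (F m) (F n) < e" if "m \<ge> N" "n \<ge> N" for m n
    proof -
      have "d \<le> (ip_dist ip f (\<lambda>z. (1/2) *s (F m z + F n z)))\<^sup>2"
        by (intro dle kernel_span_scale kernel_span_add F)
      moreover have "1 / real (Suc m) \<le> 1 / real (Suc N)" "1 / real (Suc n) \<le> 1 / real (Suc N)"
        using that by (simp_all add: frac_le)
      ultimately have "(ip_dist ip (F m) (F n))\<^sup>2 < 4 / real (Suc N)"
        using cis_parallelogram[OF cs f FH FH, of m n] F(2)[of m] F(2)[of n] by simp
      then show ?thesis using N \<open>e > 0\<close> power2_less_imp_less[of _ e] by fastforce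
    qed
    then show ?thesis by blast
  qed
  obtain g where g: "g \<in> H" "(\<lambda>n. ip_dist ip (F n) g) \<longlonglongrightarrow> 0"
    using rkhs_complete[OF R FH cauchy] by blast
  have "f = g"
  proof (rule rkhs_eq_of_pointwise_limit[OF R FH g])
    fix w :: complex and x assume w: "w \<in> ball 0 1"
    define k where "k = kernel_section K w x"
    have k: "k \<in> H" using rkhs_section[OF R w] by (simp add: k_def)
    have bound: "cmod (cinner (F n w) x - cinner (f w) x) \<le> sqrt (1 / real (Suc n) * Re (ip k k))" for n
    proof -
      have u: "(\<lambda>z. f z - F n z) \<in> H" using cis_diff[OF cs f FH] .
      have sq: "(ip_dist ip f h)\<^sup>2 = Re (ip (\<lambda>z. f z - h z) (\<lambda>z. f z - h z))" if "h \<in> H" for h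
        unfolding ip_dist_def using cis_ip_nonneg[OF cs cis_diff[OF cs f that]] by simp
      have "(cmod (ip (\<lambda>z. f z - F n z) k))\<^sup>2 \<le> (Re (ip (\<lambda>z. f z - F n z) (\<lambda>z. f z - F n z)) - d) * Re (ip k k)"
      proof (rule cis_cauchy_schwarz[OF cs u k])
        fix c
        \<comment> \<open>Moving along a section stays in the span, so the squared distance cannot
          fall below \<open>d\<close>; this is what \<open>cis_cauchy_schwarz\<close> asks for with
          \<open>e = d\<close>.\<close>
        have s: "(\<lambda>z. F n z + c *s k z) \<in> kernel_span K"
          unfolding k_def using kernel_span.step[OF F(1) w] .
        have "d \<le> (ip_dist ip f (\<lambda>z. F n z + c *s k z))\<^sup>2" using dle[OF s] .
        then show "d \<le> Re (ip (\<lambda>z. (f z - F n z) - c *s k z) (\<lambda>z. (f z - F n z) - c *s k z))"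
          unfolding sq[OF sub[OF s]] by (simp add: diff_diff_eq)
      qed
      also have "\<dots> \<le> 1 / real (Suc n) * Re (ip k k)"
        using F(2)[of n] cis_ip_nonneg[OF cs k] by (intro mult_right_mono) (auto simp: sq[OF FH])
      finally have "cmod (ip (\<lambda>z. f z - F n z) k) \<le> sqrt (1 / real (Suc n) * Re (ip k k))"
        by (rule real_le_rsqrt)
      then show ?thesis
        using cis_ip_diff[OF cs f FH k] rkhs_reproducing[OF R _ w] f FH
        by (simp add: k_def norm_minus_commute)
    qed
    have "(\<lambda>n. 1 / real (Suc n) * Re (ip k k)) \<longlonglongrightarrow> 0"
      using tendsto_mult_left_zero[OF LIMSEQ_inverse_real_of_nat] by (simp add: inverse_eq_divide)
    then have "(\<lambda>n. sqrt (1 / real (Suc n) * Re (ip k k))) \<longlonglongrightarrow> 0"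
      using tendsto_real_sqrt by fastforce
    then have "(\<lambda>n. cinner (F n w) x - cinner (f w) x) \<longlonglongrightarrow> 0"
      by (rule Lim_null_comparison[rotated]) (use bound in auto)
    then show "(\<lambda>n. cinner (F n w) x) \<longlonglongrightarrow> cinner (f w) x"
      by (simp add: LIM_zero_iff)
  qed (use rkhs_outside[OF R f] in auto)
  then show ?thesis using F(1) g(2) by blast
qed

text \<open>Approximants from the span are Cauchy in the second space too, since both inner products
  agree on the span, and evaluations identify their limit there with \<open>f\<close>. The common
  sequence is kept in the conclusion for comparing the inner products.\<close>

lemma rkhs_subset:
  assumes R: "rkhs K H ip" and R': "rkhs K H' ip'" and f: "f \<in> H"
  shows "f \<in> H' \<and> (\<exists>F. (\<forall>n. F n \<in> kernel_span K) \<and>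
    (\<lambda>n. ip_dist ip (F n) f) \<longlonglongrightarrow> 0 \<and> (\<lambda>n. ip_dist ip' (F n) f) \<longlonglongrightarrow> 0)"
proof -
  note cs = rkhs_cis[OF R] and cs' = rkhs_cis[OF R']
  obtain F where F: "\<And>n. F n \<in> kernel_span K" "(\<lambda>n. ip_dist ip (F n) f) \<longlonglongrightarrow> 0"
    using kernel_span_dense[OF R f] by blast
  have FH: "F n \<in> H" "F n \<in> H'" for n
    using F rkhs_kernel_span[OF R] rkhs_kernel_span[OF R'] by blast+
  have eq: "ip_dist ip (F m) (F n) = ip_dist ip' (F m) (F n)" for m n
  proof -
    have s: "(\<lambda>z. F m z - F n z) \<in> kernel_span K"
      using kernel_span_add[OF F(1)[of m] kernel_span_scale[OF F(1)[of n], of "-1"]] by simp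
    then show ?thesis
      unfolding ip_dist_def
      using rkhs_ip_kernel_span_eq[OF R R' _ _ s] subsetD[OF rkhs_kernel_span[OF R] s]
        subsetD[OF rkhs_kernel_span[OF R'] s] by simp
  qed
  have cauchy: "\<exists>N. \<forall>m\<ge>N. \<forall>n\<ge>N. ip_dist ip' (F m) (F n) < e" if "e > 0" for e
  proof -
    \<comment> \<open>The bound e^2/4 fits the parallelogram law: once the midpoint term is dropped,
      2 e^2/4 + 2 e^2/4 = e^2.\<close>
    have "\<forall>\<^sub>F n in sequentially. (ip_dist ip (F n) f)\<^sup>2 < e\<^sup>2 / 4"
      using order_tendstoD(2)[OF tendsto_power[OF F(2), of 2], of "e\<^sup>2 / 4"] \<open>e > 0\<close> by simp
    then obtain N where N: "\<And>n. n \<ge> N \<Longrightarrow> (ip_dist ip (F n) f)\<^sup>2 < e\<^sup>2 / 4"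
      unfolding eventually_sequentially by blast
    have sym: "ip_dist ip f g = ip_dist ip g f" if "g \<in> H" for g
      using cis_norm_diff_scale[OF cs f that, of 1] cis_norm_diff_scale[OF cs that f, of 1]
        cis_ip_cnj[OF cs f that] by (simp add: ip_dist_def)
    have "ip_dist ip (F m) (F n) < e" if "m \<ge> N" "n \<ge> N" for m n
    proof -
      have "(ip_dist ip (F m) (F n))\<^sup>2 \<le> 2 * (ip_dist ip (F m) f)\<^sup>2 + 2 * (ip_dist ip (F n) f)\<^sup>2"
        using cis_parallelogram[OF cs f FH(1) FH(1), of m n] sym FH(1) by simp
      then have "(ip_dist ip (F m) (F n))\<^sup>2 < e\<^sup>2"
        using N[OF that(1)] N[OF that(2)] by linarith
      then show ?thesis using \<open>e > 0\<close> power2_less_imp_less[of _ e] by fastforce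
    qed
    then show ?thesis unfolding eq by blast
  qed
  obtain g where g: "g \<in> H'" "(\<lambda>n. ip_dist ip' (F n) g) \<longlonglongrightarrow> 0"
    using rkhs_complete[OF R' FH(2) cauchy] by blast
  have "f = g"
  proof (rule rkhs_eq_of_pointwise_limit[OF R' FH(2) g])
    fix w :: complex and x assume w: "w \<in> ball 0 1"
    have "(\<lambda>n. ip (F n) (kernel_section K w x)) \<longlonglongrightarrow> ip f (kernel_section K w x)"
      using cis_ip_tendsto(1)[OF cs FH(1) f rkhs_section[OF R w] F(2)] .
    then show "(\<lambda>n. cinner (F n w) x) \<longlonglongrightarrow> cinner (f w) x"
      using rkhs_reproducing[OF R _ w] FH(1) f by simp
  qed (use rkhs_outside[OF R f] in auto)
  then show ?thesis using F g by blast
qed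

text \<open>The inner products agree once the second argument is in the span, so only that argument
  is approximated, by a sequence converging in both norms.\<close>

lemma rkhs_unique:
  assumes R: "rkhs K H ip" and R': "rkhs K H' ip'"
  shows "H = H'" and "\<And>f g. f \<in> H \<Longrightarrow> g \<in> H \<Longrightarrow> ip f g = ip' f g"
proof -
  show HH: "H = H'"
    using rkhs_subset[OF R R'] rkhs_subset[OF R' R] by blast
  fix f g assume f: "f \<in> H" and g: "g \<in> H"
  obtain G where G: "\<And>n. G n \<in> kernel_span K" "(\<lambda>n. ip_dist ip (G n) g) \<longlonglongrightarrow> 0"
    "(\<lambda>n. ip_dist ip' (G n) g) \<longlonglongrightarrow> 0" using rkhs_subset[OF R R' g] by blast
  have GH: "G n \<in> H" for n using G(1) rkhs_kernel_span[OF R] by blast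
  have "(\<lambda>n. ip f (G n)) \<longlonglongrightarrow> ip f g"
    using cis_ip_tendsto(2)[OF rkhs_cis[OF R] GH g f G(2)] .
  moreover have "(\<lambda>n. ip' f (G n)) \<longlonglongrightarrow> ip' f g"
    using cis_ip_tendsto(2)[OF rkhs_cis[OF R'] _ _ _ G(3)] GH f g HH by blast
  moreover have "ip f (G n) = ip' f (G n)" for n
    using rkhs_ip_kernel_span_eq[OF R R' f _ G(1)] f HH by blast
  ultimately show "ip f g = ip' f g"
    using LIMSEQ_unique by simp
qed

lemma rkhs_unitarily_equivalent:
  assumes "rkhs K H ip" "rkhs K H' ip'"
  shows "unitarily_equivalent H ip T H' ip' T"
  unfolding unitarily_equivalent_def
  using rkhs_unique[OF assms] by (intro exI[of _ "\<lambda>f. f"]) (auto simp: bij_betw_def)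

subsection \<open>Intertwiners of the curvature data\<close>

text \<open>An entry of \<open>L\<close> in row i and column j can be nonzero only if the j-th
  \<open>k\<close> equals the i-th \<open>l\<close>, and a nonzero determinant supplies a
  permutation of nonzero entries. The nilpotent relation kills entries below the diagonal unless
  neighbouring values coincide. So adjacent transpositions give the same matching as the identity,
  and the other permutations contradict \<open>k0 < k2\<close> or \<open>l0 < l2\<close>.\<close>

lemma intertwiner_diag_eq:
  fixes L :: "complex^3^3" and k0 k1 k2 l0 l1 l2 :: real
  assumes "invertible L"
    and K: "L ** diag3 (of_real k0) (of_real k1) (of_real k2) =
      diag3 (of_real l0) (of_real l1) (of_real l2) ** L"
    and N: "L ** transpose (shift n1 n2) = transpose (shift n1' n2') ** L"
    and n: "n1 = 0 \<Longrightarrow> k0 = k1" "n2 = 0 \<Longrightarrow> k1 = k2" "n1' = 0 \<Longrightarrow> l0 = l1" "n2' = 0 \<Longrightarrow> l1 = l2"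
    and "k0 < k2" "l0 < l2"
  shows "k0 = l0 \<and> k1 = l1 \<and> k2 = l2"
proof -
  have "det L \<noteq> 0"
    using assms(1) by (simp add: invertible_det_nz)
  have e: "L $ 1 $ 1 = 0 \<or> k0 = l0" "L $ 1 $ 2 = 0 \<or> k1 = l0" "L $ 1 $ 3 = 0 \<or> k2 = l0"
    "L $ 2 $ 1 = 0 \<or> k0 = l1" "L $ 2 $ 2 = 0 \<or> k1 = l1" "L $ 2 $ 3 = 0 \<or> k2 = l1"
    "L $ 3 $ 1 = 0 \<or> k0 = l2" "L $ 3 $ 2 = 0 \<or> k1 = l2" "L $ 3 $ 3 = 0 \<or> k2 = l2"
    using K by (simp_all add: mat3_simps mult.commute)
  \<comment> \<open>First column and last row of the relation \<open>N\<close>, where one of the two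
    sides vanishes.\<close>
  have ne: "n1' * L $ 2 $ 1 = 0" "n2' * L $ 3 $ 1 = 0" "L $ 3 $ 1 * n1 = 0" "L $ 3 $ 2 * n2 = 0"
    using N by (simp_all add: mat3_simps)
  have n': "L $ 2 $ 1 = 0 \<or> l0 = l1" "L $ 3 $ 1 = 0 \<or> l1 = l2 \<and> k0 = k1" "L $ 3 $ 2 = 0 \<or> k1 = k2"
    using ne n by auto
  have "p1 \<noteq> 0 \<or> p2 \<noteq> 0 \<or> p3 \<noteq> 0 \<or> p4 \<noteq> 0 \<or> p5 \<noteq> 0 \<or> p6 \<noteq> 0"
    if "p1 + p2 + p3 - p4 - p5 - p6 \<noteq> 0" for p1 p2 p3 p4 p5 p6 :: complex
    using that by auto
  from this[OF \<open>det L \<noteq> 0\<close>[unfolded det_3]] consider "L $ 1 $ 1 * L $ 2 $ 2 * L $ 3 $ 3 \<noteq> 0" | "L $ 1 $ 2 * L $ 2 $ 3 * L $ 3 $ 1 \<noteq> 0"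
    | "L $ 1 $ 3 * L $ 2 $ 1 * L $ 3 $ 2 \<noteq> 0" | "L $ 1 $ 1 * L $ 2 $ 3 * L $ 3 $ 2 \<noteq> 0"
    | "L $ 1 $ 2 * L $ 2 $ 1 * L $ 3 $ 3 \<noteq> 0" | "L $ 1 $ 3 * L $ 2 $ 2 * L $ 3 $ 1 \<noteq> 0"
    by blast
  then show ?thesis
  proof cases
    case 1
    then show ?thesis using e(1,5,9) by auto
  next
    case 2
    then show ?thesis using e(2,6,7) n'(2) \<open>k0 < k2\<close> by auto
  next
    case 3
    then show ?thesis using e(3,4,8) n'(1) \<open>k0 < k2\<close> by auto
  next
    case 4
    then show ?thesis using e(1,6,8) n'(3) by auto
  next
    case 5
    then show ?thesis using e(2,4,9) n'(1) by auto
  next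
    case 6
    then show ?thesis using e(3,5,7) n'(2) \<open>k0 < k2\<close> \<open>l0 < l2\<close> by auto
  qed
qed

section \<open>Curvature data of the homogeneous kernel\<close>

lemma dcoef_values:
  assumes "admissible lam \<mu>"
  shows "dcoef lam \<mu> 0 = 1"
    and "dcoef lam \<mu> (Suc 0) = 1 / (2 * lam - 2) + (\<mu> 1)\<^sup>2"
    and "dcoef lam \<mu> 2 = 2 / ((2 * lam - 2) * (2 * lam - 1)) + 2 / lam * (\<mu> 1)\<^sup>2 + (\<mu> 2)\<^sup>2"
  using assms
  by (simp_all add: admissible_def dcoef_def numeral_2_eq_2 pochhammer_Suc field_simps)

lemma dcoef_pos:
  assumes "admissible lam \<mu>"
  shows "dcoef lam \<mu> (Suc 0) > 0" "dcoef lam \<mu> 2 > 0"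
  using assms unfolding dcoef_values[OF assms] admissible_def
  by (auto intro!: add_pos_pos mult_pos_pos divide_pos_pos)

lemma Kker_eqI:
  assumes "admissible lam \<mu>" "admissible lam \<nu>"
    and "dcoef lam \<mu> (Suc 0) = dcoef lam \<nu> (Suc 0)" "dcoef lam \<mu> 2 = dcoef lam \<nu> 2"
  shows "Kker lam \<mu> = Kker lam \<nu>"
  using assms dcoef_values(1)[OF assms(1)] dcoef_values(1)[OF assms(2)]
  by (simp add: Kker_def[abs_def] Bmat_def)

definition curv_a :: "real \<Rightarrow> (nat \<Rightarrow> real) \<Rightarrow> real" where
  "curv_a lam \<mu> = 1 / dcoef lam \<mu> 1"

definition curv_b :: "real \<Rightarrow> (nat \<Rightarrow> real) \<Rightarrow> real" where
  "curv_b lam \<mu> = 4 * dcoef lam \<mu> 1 / dcoef lam \<mu> 2"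

lemma curv_pos:
  assumes "admissible lam \<mu>"
  shows "curv_a lam \<mu> > 0" "curv_b lam \<mu> > 0"
  using dcoef_pos[OF assms] by (simp_all add: curv_a_def curv_b_def)

text \<open>The radial factors have derivatives (-2, -1, 0) and (2 lam, 2 lam + 1, 2 lam + 2) at 0,
  and the commutator A T - T A adds (-a, a - b, b). Each superdiagonal entry of the covariant
  derivative is minus a shift weight times the gap between neighbouring curvature
  eigenvalues.\<close>

lemma curvature_Kker:
  assumes "admissible lam \<mu>"
  defines "a \<equiv> curv_a lam \<mu>" and "b \<equiv> curv_b lam \<mu>" and "h \<equiv> kernel_metric (Kker lam \<mu>)"
  shows "curvature h 0 = diag3 (of_real (2 * lam - 2 - a)) (of_real (2 * lam + a - b))
      (of_real (2 * lam + 2 + b))"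
    and "curvature_zbar h 0 = transpose (shift (of_real (- sqrt a * (2 + 2 * a - b)))
      (of_real (- sqrt b * (2 + 2 * b - a))))"
proof -
  define p where "p = (\<lambda>x::complex. (1 - x) powr complex_of_real (- 2 * lam - 2))"
  define \<alpha> \<beta> where "\<alpha> = complex_of_real (sqrt a)" and "\<beta> = complex_of_real (sqrt b)"
  have ab: "a > 0" "b > 0" using curv_pos[OF assms(1)] by (simp_all add: a_def b_def)
  have \<alpha>: "complex_of_real (1 / sqrt (dcoef lam \<mu> 1)) = \<alpha>"
    by (simp add: \<alpha>_def a_def curv_a_def real_sqrt_divide)
  have \<beta>: "complex_of_real (2 * sqrt (dcoef lam \<mu> 1) / sqrt (dcoef lam \<mu> 2)) = \<beta>"
    by (simp add: \<beta>_def b_def curv_b_def real_sqrt_divide real_sqrt_mult)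
  have "1 - 0 \<notin> (\<real>\<^sub>\<le>\<^sub>0 :: complex set)" by simp
  then have p: "p analytic_on {0}"
    unfolding p_def by (intro analytic_intros) auto
  have dp: "(p has_field_derivative of_real (2 * lam + 2)) (at 0)"
  proof -
    define c where "c = complex_of_real (- 2 * lam - 2)"
    have "((\<lambda>x. (1 - x) powr c) has_field_derivative c * 1 powr (c - 1) * (- 1)) (at 0)"
      by (rule DERIV_chain2[where f = "\<lambda>u. u powr c" and g = "\<lambda>x. 1 - x"])
         (auto intro!: derivative_eq_intros has_field_derivative_powr)
    then show ?thesis by (simp add: p_def c_def add.commute)
  qed
  have an: "(\<lambda>x::complex. (1 - x)\<^sup>2) analytic_on {0}" "(\<lambda>x::complex. 1 - x) analytic_on {0}"
    "(\<lambda>x::complex. 1::complex) analytic_on {0}" "(\<lambda>x. p x * (1 - x)\<^sup>2) analytic_on {0}"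
    "(\<lambda>x. p x * (1 - x)) analytic_on {0}"
    by (intro analytic_intros p)+
  have p0: "p 0 = 1" by (simp add: p_def)
  have l: "((\<lambda>x::complex. 1 - x) has_field_derivative -1) (at 0)"
    and s: "((\<lambda>x::complex. (1 - x)\<^sup>2) has_field_derivative -2) (at 0)"
    by (auto intro!: derivative_eq_intros)
  have "((\<lambda>x. p x * (1 - x)\<^sup>2) has_field_derivative of_real (2 * lam)) (at 0)"
    "((\<lambda>x. p x * (1 - x)) has_field_derivative of_real (2 * lam + 1)) (at 0)"
    using DERIV_mult[OF dp s] DERIV_mult[OF dp l] by (simp_all add: p0 add.commute)
  then have d: "deriv (\<lambda>x::complex. (1 - x)\<^sup>2) 0 = -2" "deriv (\<lambda>x::complex. 1 - x) 0 = -1"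
    "deriv (\<lambda>x. p x * (1 - x)\<^sup>2) 0 = of_real (2 * lam)"
    "deriv (\<lambda>x. p x * (1 - x)) 0 = of_real (2 * lam + 1)" "deriv p 0 = of_real (2 * lam + 2)"
    using l s dp by (simp_all only: DERIV_imp_deriv)
  have ev: "\<forall>\<^sub>F z in nhds 0. h z = transpose (shift_exp \<alpha> \<beta> (- cnj z)) **
     diag_radial (\<lambda>x. (1 - x)\<^sup>2) (\<lambda>x. 1 - x) (\<lambda>x. 1) z ** shift_exp \<alpha> \<beta> z ** transpose (shift_exp \<alpha> \<beta> (cnj z)) **
     diag_radial (\<lambda>x. p x * (1 - x)\<^sup>2) (\<lambda>x. p x * (1 - x)) p z ** shift_exp \<alpha> \<beta> (- z)"
    by (intro always_eventually allI) (simp only: h_def p_def kernel_metric_Kker[OF dcoef_values(1)[OF assms(1)] dcoef_pos[OF assms(1)]] \<alpha> \<beta>)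
  have one: "(1 - 0)\<^sup>2 = (1::complex)" "1 - 0 = (1::complex)" "(1::complex) = 1"
    "p 0 * (1 - 0)\<^sup>2 = 1" "p 0 * (1 - 0) = 1"
    by (simp_all add: p0)
  note C = curvature_model[OF an p one p0 ev, unfolded d deriv_const]
  have sq: "\<alpha> * \<alpha> = of_real a" "\<beta> * \<beta> = of_real b"
    using ab by (simp_all add: \<alpha>_def \<beta>_def flip: of_real_mult)
  have sq': "\<alpha> * (\<alpha> * x) = of_real a * x" "\<beta> * (\<beta> * x) = of_real b * x" for x
    using sq by (simp_all flip: mult.assoc)
  show "curvature h 0 = diag3 (of_real (2 * lam - 2 - a)) (of_real (2 * lam + a - b))
      (of_real (2 * lam + 2 + b))"
    unfolding C(1) by (simp add: mat3_simps sq algebra_simps)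
  show "curvature_zbar h 0 = transpose (shift (of_real (- sqrt a * (2 + 2 * a - b)))
      (of_real (- sqrt b * (2 + 2 * b - a))))"
    unfolding C(2) of_real_mult of_real_minus \<alpha>_def[symmetric] \<beta>_def[symmetric]
    by (simp add: mat3_simps sq sq' scaleR_conv_of_real[where 'a = complex] algebra_simps)
qed

theorem theorem3p20:
  fixes lam lam' :: real and \<mu> \<nu> :: "nat \<Rightarrow> real"
    and H H' :: "(complex \<Rightarrow> complex^3) set"
    and ip ip' :: "(complex \<Rightarrow> complex^3) \<Rightarrow> (complex \<Rightarrow> complex^3) \<Rightarrow> complex"
    and h h' :: "complex \<Rightarrow> complex^3^3"
  defines "h \<equiv> kernel_metric (Kker lam \<mu>)"
    and "h' \<equiv> kernel_metric (Kker lam' \<nu>)"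
  assumes "admissible lam \<mu>" and "admissible lam' \<nu>"
    and "rkhs (Kker lam \<mu>) H ip" and "rkhs (Kker lam' \<nu>) H' ip'"
    and "\<not> unitarily_equivalent H ip mult_coord H' ip' mult_coord"
    and "\<forall>z\<in>ball 0 1. curvatures_unitarily_equivalent h h' z"
  shows "\<not> (\<exists>L :: complex^3^3. invertible L \<and>
            L ** curvature h 0 = curvature h' 0 ** L \<and>
            L ** curvature_zbar h 0 = curvature_zbar h' 0 ** L)"
proof
  assume "\<exists>L :: complex^3^3. invertible L \<and>
            L ** curvature h 0 = curvature h' 0 ** L \<and>
            L ** curvature_zbar h 0 = curvature_zbar h' 0 ** L"
  then obtain L :: "complex^3^3" where L: "invertible L"
    "L ** curvature h 0 = curvature h' 0 ** L" "L ** curvature_zbar h 0 = curvature_zbar h' 0 ** L"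
    by blast
  define a b a' b' where "a = curv_a lam \<mu>" and "b = curv_b lam \<mu>"
    and "a' = curv_a lam' \<nu>" and "b' = curv_b lam' \<nu>"
  have pos: "a > 0" "b > 0" "a' > 0" "b' > 0"
    using curv_pos assms(3,4) by (simp_all add: a_def b_def a'_def b'_def)
  \<comment> \<open>A vanishing superdiagonal entry means a vanishing eigenvalue gap
    \<open>y\<close>, since the factor \<open>sqrt x\<close> is positive.\<close>
  have zero: "y = 0" if "complex_of_real (- sqrt x * y) = 0" "x > 0" for x y
    using that unfolding of_real_eq_0_iff by simp
  have "2 * lam - 2 - a = 2 * lam' - 2 - a' \<and> 2 * lam + a - b = 2 * lam' + a' - b' \<and>
      2 * lam + 2 + b = 2 * lam' + 2 + b'"
  proof (rule intertwiner_diag_eq[OF L[unfolded h_def h'_def curvature_Kker[OF assms(3)]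
          curvature_Kker[OF assms(4)], folded a_def b_def a'_def b'_def]])
    show "2 * lam - 2 - a = 2 * lam + a - b" if "complex_of_real (- sqrt a * (2 + 2 * a - b)) = 0"
      using zero[OF that] pos by simp
    show "2 * lam + a - b = 2 * lam + 2 + b" if "complex_of_real (- sqrt b * (2 + 2 * b - a)) = 0"
      using zero[OF that] pos by simp
    show "2 * lam' - 2 - a' = 2 * lam' + a' - b'" if "complex_of_real (- sqrt a' * (2 + 2 * a' - b')) = 0"
      using zero[OF that] pos by simp
    show "2 * lam' + a' - b' = 2 * lam' + 2 + b'" if "complex_of_real (- sqrt b' * (2 + 2 * b' - a')) = 0"
      using zero[OF that] pos by simp
  qed (use pos in simp_all)
  \<comment> \<open>The three eigenvalues add up to 6 lam, so lam is recovered first; the first and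
    last then give a and b.\<close>
  then have "lam = lam'" and ab: "a = a'" "b = b'" by linarith+
  \<comment> \<open>\<open>a\<close> determines d_1, and then \<open>b\<close> determines d_2;
    together with lam they fix the whole kernel.\<close>
  have d: "dcoef lam \<mu> 1 = dcoef lam \<nu> 1" "dcoef lam \<mu> 2 = dcoef lam \<nu> 2"
    using ab dcoef_pos[OF assms(3)] dcoef_pos[OF assms(4)] unfolding \<open>lam = lam'\<close>
    by (simp_all add: a_def b_def a'_def b'_def curv_a_def curv_b_def \<open>lam = lam'\<close>)
  then have "Kker lam \<mu> = Kker lam' \<nu>"
    using Kker_eqI[OF assms(3) assms(4)[folded \<open>lam = lam'\<close>]] \<open>lam = lam'\<close> by simp
  then show False
    using rkhs_unitarily_equivalent[of _ H ip H' ip'] assms(5,6,7) by simp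
qed

end
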